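(* There is a uniform, deterministic algorithm in the parallel independence-oracle model that, for any graphic matroid on $m$ elements, finds a basis using $O(\log(m)\log\log(m))$ rounds, with $\mathrm{poly}(m)$ independence queries per round.
   Context: A graphic matroid on ground set $E$ ($|E|=m$) comes from an (unknown) graph $G=(V,E)$: a set $S\subseteq E$ is independent iff $S$ contains no cycle of $G$; a basis is an inclusion-maximal independent set (a spanning forest of $G$). The algorithm has access to the matroid only through an independence oracle $\mathrm{Ind}:2^E\to\{0,1\}$, $\mathrm{Ind}(S)=1$ iff $S$ is independent. It operates in rounds: in each round it submits a batch of queries (subsets of $E$), chosen as a function of $m$ and the answers received in previous rounds, and then receives all answers. Uniform and deterministic means the queries and output are computed by a single fixed explicit deterministic procedure (no randomness, no non-uniform advice). *)

theory Defs
  imports Complex_Main "HOL-Library.Nat_Bijection" "HOL-Library.Landau_Symbols"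
begin

section \<open>Graphic matroids\<close>

text \<open>Finite undirected multigraphs; loops (one endpoint) and parallel edges are allowed, so that
  every graphic matroid is covered.\<close>

record ('v, 'e) mgraph =
  verts :: "'v set"
  edges :: "'e set"
  ends :: "'e \<Rightarrow> 'v set"

definition wf_mgraph :: "('v, 'e) mgraph \<Rightarrow> bool" where
  "wf_mgraph G \<longleftrightarrow> finite (verts G) \<and> finite (edges G) \<and>
     (\<forall>e\<in>edges G. ends G e \<subseteq> verts G \<and> card (ends G e) \<in> {1, 2})"

text \<open>A cycle \<open>v\<^sub>0 e\<^sub>0 v\<^sub>1 e\<^sub>1 \<dots> v\<^sub>k\<^sub>-\<^sub>1 e\<^sub>k\<^sub>-\<^sub>1 v\<^sub>0\<close>; a loop is a cycle of length 1, two parallel edges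
  form a cycle of length 2.\<close>

definition is_cycle :: "('v, 'e) mgraph \<Rightarrow> 'v list \<Rightarrow> 'e list \<Rightarrow> bool" where
  "is_cycle G vs es \<longleftrightarrow>
     es \<noteq> [] \<and> length vs = length es \<and> distinct vs \<and> distinct es \<and>
     set vs \<subseteq> verts G \<and> set es \<subseteq> edges G \<and>
     (\<forall>i<length es. ends G (es ! i) = {vs ! i, vs ! (Suc i mod length es)})"

definition contains_cycle :: "('v, 'e) mgraph \<Rightarrow> 'e set \<Rightarrow> bool" where
  "contains_cycle G S \<longleftrightarrow> (\<exists>vs es. is_cycle G vs es \<and> set es \<subseteq> S)"

text \<open>\<open>Ind\<close> is the independence predicate of a graphic matroid on the ground set \<open>E\<close>. As graphs
  are finite, taking the vertices to be natural numbers is no restriction.\<close>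

definition graphic_matroid :: "'e set \<Rightarrow> ('e set \<Rightarrow> bool) \<Rightarrow> bool" where
  "graphic_matroid E Ind \<longleftrightarrow>
     (\<exists>G :: (nat, 'e) mgraph. wf_mgraph G \<and> edges G = E \<and>
        (\<forall>S. Ind S \<longleftrightarrow> S \<subseteq> E \<and> \<not> contains_cycle G S))"

definition matroid_basis :: "('e set \<Rightarrow> bool) \<Rightarrow> 'e set \<Rightarrow> bool" where
  "matroid_basis Ind B \<longleftrightarrow> Ind B \<and> (\<forall>S. Ind S \<and> B \<subseteq> S \<longrightarrow> S = B)"


section \<open>Computable functions\<close>

text \<open>The total (general) recursive functions: the least class of functions containing the basic
  functions and closed under composition, primitive recursion and minimisation of regular
  functions. Several arguments are passed through the Cantor pairing \<^const>\<open>prod_encode\<close>.\<close>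

inductive computable :: "(nat \<Rightarrow> nat) \<Rightarrow> bool" where
  computable_zero: "computable (\<lambda>_. 0)"
| computable_Suc: "computable Suc"
| computable_fst: "computable (\<lambda>x. fst (prod_decode x))"
| computable_snd: "computable (\<lambda>x. snd (prod_decode x))"
| computable_pair:
    "computable f \<Longrightarrow> computable g \<Longrightarrow> computable (\<lambda>x. prod_encode (f x, g x))"
| computable_comp:
    "computable f \<Longrightarrow> computable g \<Longrightarrow> computable (\<lambda>x. f (g x))"
| computable_rec:
    "computable f \<Longrightarrow> computable g \<Longrightarrow>
     computable (\<lambda>x. rec_nat (f (fst (prod_decode x)))
       (\<lambda>k r. g (prod_encode (fst (prod_decode x), prod_encode (k, r)))) (snd (prod_decode x)))"
| computable_min:
    "computable f \<Longrightarrow> (\<And>a. \<exists>n. f (prod_encode (a, n)) = 0) \<Longrightarrow>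
     computable (\<lambda>a. LEAST n. f (prod_encode (a, n)) = 0)"


section \<open>The parallel independence-oracle model\<close>

text \<open>The ground set of an instance of size \<open>m\<close> is \<open>{..<m}\<close>. Given \<open>m\<close> and the answers of all
  previous rounds (one list of answers per round), a deterministic algorithm either submits the
  next batch of queries or stops with an output.\<close>

datatype action = Query "nat set list" | Return "nat set"

type_synonym algorithm = "nat \<Rightarrow> bool list list \<Rightarrow> action"

text \<open>\<open>h\<close> is the complete transcript of the (unique) run on \<open>m\<close> elements with oracle \<open>Ind\<close>:
  \<open>length h\<close> is the number of rounds, \<open>length (h ! i)\<close> the number of queries in round \<open>i\<close>.\<close>

definition run :: "algorithm \<Rightarrow> nat \<Rightarrow> (nat set \<Rightarrow> bool) \<Rightarrow> bool list list \<Rightarrow> nat set \<Rightarrow> bool" where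
  "run A m Ind h B \<longleftrightarrow>
     (\<forall>i<length h. \<exists>qs. A m (take i h) = Query qs \<and> (\<forall>S\<in>set qs. S \<subseteq> {..<m}) \<and>
        h ! i = map Ind qs) \<and>
     A m h = Return B"

definition encode_input :: "nat \<Rightarrow> bool list list \<Rightarrow> nat" where
  "encode_input m h = prod_encode (m, list_encode (map (\<lambda>as. list_encode (map of_bool as)) h))"

definition decode_action :: "nat \<Rightarrow> action" where
  "decode_action c = (case sum_decode c of
       Inl b \<Rightarrow> Query (map set_decode (list_decode b))
     | Inr s \<Rightarrow> Return (set_decode s))"

text \<open>Uniformity: one computable function serves all sizes \<open>m\<close>. An arbitrary function of type
  \<^typ>\<open>algorithm\<close> could hide non-uniform advice in its dependence on \<open>m\<close>.\<close>

definition uniform :: "algorithm \<Rightarrow> bool" where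
  "uniform A \<longleftrightarrow> (\<exists>f. computable f \<and> (\<forall>m h. A m h = decode_action (f (encode_input m h))))"

end

theory Submission
  imports Defs
begin

text \<open>The edges are processed in rounds; before a round the surviving edge set \<open>E\<close> has girth at least
  \<open>g\<close>. For every set \<open>S\<close> of a fixed family the round queries all sets \<open>S \<inter> E \<inter> {..<k}\<close>, and deletes \<open>e\<close>
  whenever \<open>S \<inter> E \<inter> {..<e}\<close> is independent but \<open>S \<inter> E \<inter> {..e}\<close> is not: then \<open>e\<close> is spanned by smaller
  edges, so all these deletions together preserve the span. A cycle \<open>C\<close> of length at most \<open>3 * g / 2\<close>
  loses its largest edge as soon as some \<open>S\<close> in the family contains \<open>C\<close>, but no cycle avoiding that
  edge. Hence the girth grows by a factor \<open>3 / 2\<close> per round, and after \<open>O(log m)\<close> rounds the survivors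
  form a basis.

  A random set that contains each edge with probability \<open>(2 * m + 1) powr (- 62 / g)\<close> isolates a given \<open>C\<close>
  with probability at least \<open>1 / (2 * (2 * m + 1) ^ 93)\<close>, since a graph of girth \<open>g\<close> has only \<open>m\<close> to the
  power \<open>O(l / g)\<close> cycles of length \<open>l\<close>. There are only exponentially many graphs with \<open>m\<close> edges, so
  polynomially many sets isolate all short cycles of all of them. Such a family is found uniformly
  by exhaustive search.\<close>

section \<open>Closure properties of computable functions\<close>

named_theorems computable_intros

definition decidable :: "(nat \<Rightarrow> bool) \<Rightarrow> bool" where
  "decidable P \<longleftrightarrow> computable (\<lambda>x. of_bool (P x))"

lemma computable_fst' [computable_intros]:
  "computable f \<Longrightarrow> computable (\<lambda>x. fst (prod_decode (f x)))"
  using computable_comp[OF computable_fst] by simp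

lemma computable_snd' [computable_intros]:
  "computable f \<Longrightarrow> computable (\<lambda>x. snd (prod_decode (f x)))"
  using computable_comp[OF computable_snd] by simp

lemma computable_Suc' [computable_intros]: "computable f \<Longrightarrow> computable (\<lambda>x. Suc (f x))"
  using computable_comp[OF computable_Suc] by simp

lemmas [computable_intros] = computable_pair

lemma computable_ident [computable_intros]: "computable (\<lambda>x. x)"
proof -
  have "computable (\<lambda>x. prod_encode (fst (prod_decode x), snd (prod_decode x)))"
    by (intro computable_pair computable_fst computable_snd)
  then show ?thesis by simp
qed

lemma computable_const [computable_intros]: "computable (\<lambda>_. c)"
  by (induction c) (auto intro: computable_zero computable_Suc')

text \<open>In the rules for binders the bound variable and its context are passed as one paired argument;
  higher-order unification then reduces nested binders to chains of projections.\<close>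

lemma computable_rec_nat [computable_intros]:
  assumes "computable b" "computable z"
    and s: "computable (\<lambda>y. s (fst (prod_decode y)) (fst (prod_decode (snd (prod_decode y))))
                     (snd (prod_decode (snd (prod_decode y)))))"
  shows "computable (\<lambda>x. rec_nat (z x) (s x) (b x))"
proof -
  have "computable (\<lambda>x. prod_encode (x, b x))"
    by (intro computable_intros assms)
  from computable_comp[OF computable_rec[OF assms(2) s] this] show ?thesis
    by simp
qed

section \<open>Arithmetic, decidable relations and bounded search\<close>

lemma computable_add [computable_intros]:
  assumes "computable f" "computable g"
  shows "computable (\<lambda>x. f x + g x)"
proof -
  have "rec_nat c (\<lambda>_ r. Suc r) n = c + n" for c n by (induction n) auto
  moreover have "computable (\<lambda>x. rec_nat (f x) (\<lambda>_ r. Suc r) (g x))"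
    by (intro computable_intros assms)
  ultimately show ?thesis by simp
qed

lemma computable_sum [computable_intros]:
  assumes "computable b" "computable (\<lambda>y. f (fst (prod_decode y)) (snd (prod_decode y)))"
  shows "computable (\<lambda>x. \<Sum>k<b x. f x k)"
proof -
  have "computable (\<lambda>y. prod_encode (fst (prod_decode y), fst (prod_decode (snd (prod_decode y)))))"
    by (intro computable_intros)
  from computable_comp[OF assms(2) this]
  have "computable (\<lambda>y. f (fst (prod_decode y)) (fst (prod_decode (snd (prod_decode y)))))"
    by simp
  then have "computable (\<lambda>x. rec_nat 0 (\<lambda>k r. r + f x k) (b x))"
    by (intro computable_intros assms)
  moreover have "rec_nat 0 (\<lambda>k r. r + f x k) n = (\<Sum>k<n. f x k)" for x n
    by (induction n) auto
  ultimately show ?thesis by simp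
qed

lemma computable_mult [computable_intros]:
  assumes "computable f" "computable g"
  shows "computable (\<lambda>x. f x * g x)"
proof -
  have "computable (\<lambda>x. \<Sum>k<g x. f x)"
    by (intro computable_intros assms computable_comp[OF assms(1)])
  then show ?thesis by (simp add: mult.commute)
qed

lemma computable_power [computable_intros]:
  assumes "computable f" "computable g"
  shows "computable (\<lambda>x. f x ^ g x)"
proof -
  have "rec_nat 1 (\<lambda>_ r. r * c) n = c ^ n" for c n :: nat by (induction n) auto
  moreover have "computable (\<lambda>x. rec_nat 1 (\<lambda>_ r. r * f x) (g x))"
    by (intro computable_intros assms computable_comp[OF assms(1)])
  ultimately show ?thesis by simp
qed

lemma computable_diff [computable_intros]:
  assumes "computable f" "computable g"
  shows "computable (\<lambda>x. f x - g x)"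
proof -
  have pred: "rec_nat 0 (\<lambda>k r. k) n = n - 1" for n by (cases n) auto
  have "rec_nat c (\<lambda>_ r. rec_nat 0 (\<lambda>k r. k) r) n = c - n" for c n by (induction n) (auto simp: pred)
  moreover have "computable (\<lambda>x. rec_nat (f x) (\<lambda>_ r. rec_nat 0 (\<lambda>k r. k) r) (g x))"
    by (intro computable_intros assms)
  ultimately show ?thesis by simp
qed

lemma computable_of_bool [computable_intros]:
  "decidable P \<Longrightarrow> computable (\<lambda>x. of_bool (P x))"
  by (simp add: decidable_def)

lemma decidable_comp: "decidable P \<Longrightarrow> computable f \<Longrightarrow> decidable (\<lambda>x. P (f x))"
  unfolding decidable_def by (rule computable_comp)

lemma decidable_less [computable_intros]:
  assumes "computable f" "computable g"
  shows "decidable (\<lambda>x. f x < g x)"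
proof -
  \<comment> \<open>With truncated subtraction, \<open>1 - (1 - n)\<close> is 0 for
    \<open>n = 0\<close> and 1 otherwise.\<close>
  have "computable (\<lambda>x. 1 - (1 - (g x - f x)))"
    by (intro computable_intros assms)
  moreover have "1 - (1 - (b - a)) = of_bool (a < b)" for a b :: nat by auto
  ultimately show ?thesis by (simp only: decidable_def)
qed

lemma decidable_not [computable_intros]:
  assumes "decidable P"
  shows "decidable (\<lambda>x. \<not> P x)"
proof -
  have "computable (\<lambda>x. 1 - of_bool (P x))"
    by (intro computable_intros assms)
  moreover have "1 - of_bool b = (of_bool (\<not> b) :: nat)" for b by auto
  ultimately show ?thesis by (simp only: decidable_def)
qed

lemma decidable_conj [computable_intros]:
  assumes "decidable P" "decidable Q"
  shows "decidable (\<lambda>x. P x \<and> Q x)"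
proof -
  have "computable (\<lambda>x. of_bool (P x) * of_bool (Q x))"
    by (intro computable_intros assms)
  then show ?thesis by (simp only: decidable_def of_bool_conj)
qed

lemma decidable_imp [computable_intros]:
  assumes "decidable P" "decidable Q"
  shows "decidable (\<lambda>x. P x \<longrightarrow> Q x)"
proof -
  have "decidable (\<lambda>x. \<not> (P x \<and> \<not> Q x))"
    by (intro computable_intros assms)
  then show ?thesis by (simp only: not_imp[symmetric] not_not)
qed

lemma decidable_disj [computable_intros]:
  assumes "decidable P" "decidable Q"
  shows "decidable (\<lambda>x. P x \<or> Q x)"
proof -
  have "decidable (\<lambda>x. \<not> P x \<longrightarrow> Q x)"
    by (intro computable_intros assms)
  then show ?thesis by (simp only: disj_imp)
qed

lemma decidable_le [computable_intros]:
  assumes "computable f" "computable g"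
  shows "decidable (\<lambda>x. f x \<le> g x)"
  using decidable_not[OF decidable_less[OF assms(2,1)]] by (simp add: not_less)

lemma decidable_eq [computable_intros]:
  assumes "computable f" "computable g"
  shows "decidable (\<lambda>x. f x = g x)"
proof -
  have "decidable (\<lambda>x. f x \<le> g x \<and> g x \<le> f x)"
    by (intro computable_intros assms)
  moreover have "(\<lambda>x. f x = g x) = (\<lambda>x. f x \<le> g x \<and> g x \<le> f x)"
    by auto
  ultimately show ?thesis by (simp only:)
qed

lemma decidable_bex_less [computable_intros]:
  assumes "computable b" "decidable (\<lambda>y. P (fst (prod_decode y)) (snd (prod_decode y)))"
  shows "decidable (\<lambda>x. \<exists>k<b x. P x k)"
proof -
  have "decidable (\<lambda>x. 0 < (\<Sum>k<b x. of_bool (P x k) :: nat))"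
    by (intro computable_intros assms)
  moreover have "0 < (\<Sum>k<n. of_bool (Q k)::nat) \<longleftrightarrow> (\<exists>k<n. Q k)" for n :: nat and Q
    by (induction n) (auto simp: less_Suc_eq)
  ultimately show ?thesis by (simp only:)
qed

lemma decidable_ball_less [computable_intros]:
  assumes "computable b" "decidable (\<lambda>y. P (fst (prod_decode y)) (snd (prod_decode y)))"
  shows "decidable (\<lambda>x. \<forall>k<b x. P x k)"
proof -
  have "decidable (\<lambda>x. \<not> (\<exists>k<b x. \<not> P x k))"
    by (intro computable_intros assms)
  then show ?thesis by simp
qed

lemma computable_Least [computable_intros]:
  assumes P: "decidable (\<lambda>y. P (fst (prod_decode y)) (snd (prod_decode y)))"
    and ex: "\<And>x. \<exists>n. P x n"
  shows "computable (\<lambda>x. LEAST n. P x n)"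
proof -
  have "computable (\<lambda>y. of_bool (\<not> P (fst (prod_decode y)) (snd (prod_decode y))))"
    by (intro computable_intros P)
  from computable_min[OF this] ex show ?thesis by simp
qed

lemma computable_If [computable_intros]:
  assumes "decidable P" "computable f" "computable g"
  shows "computable (\<lambda>x. if P x then f x else g x)"
proof -
  have "computable (\<lambda>x. of_bool (P x) * f x + of_bool (\<not> P x) * g x)"
    by (intro computable_intros assms)
  moreover have "of_bool b * u + of_bool (\<not> b) * v = (if b then u else v)" for b and u v :: nat
    by auto
  ultimately show ?thesis by (simp only:)
qed

lemma computable_div [computable_intros]:
  assumes "computable f" "computable g"
  shows "computable (\<lambda>x. f x div g x)"
proof -
  \<comment> \<open>The quotient is found by unbounded search. The disjunct \<open>g x = 0\<close>
    lets the search succeed at \<open>q = 0\<close> for a zero divisor, which is also the value of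
    \<open>f x div 0\<close>.\<close>
  have *: "(LEAST q. g x = 0 \<or> f x < Suc q * g x) = f x div g x" for x
  proof (cases "g x = 0")
    case True
    then show ?thesis by (intro Least_equality) auto
  next
    case False
    then have "f x < Suc q * g x \<longleftrightarrow> f x div g x \<le> q" for q
      by (metis div_less_iff_less_mult less_Suc_eq_le neq0_conv)
    with False show ?thesis by (intro Least_equality) auto
  qed
  have comp: "computable (\<lambda>y. f (h y))" "computable (\<lambda>y. g (h y))" if "computable h" for h
    using computable_comp[OF assms(1) that] computable_comp[OF assms(2) that] by auto
  have "computable (\<lambda>x. LEAST q. g x = 0 \<or> f x < Suc q * g x)"
  proof (rule computable_Least)
    fix x
    have "f x < Suc (f x) * g x" if "g x \<noteq> 0"
      using that by (metis lessI less_le_trans mult.right_neutral mult_le_mono2 Suc_leI neq0_conv One_nat_def)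
    then show "\<exists>q. g x = 0 \<or> f x < Suc q * g x" by (intro exI[of _ "f x"]) blast
  qed (intro computable_intros comp)
  then show ?thesis by (simp only: *)
qed

lemma computable_mod [computable_intros]:
  assumes "computable f" "computable g"
  shows "computable (\<lambda>x. f x mod g x)"
proof -
  have "computable (\<lambda>x. f x - f x div g x * g x)"
    by (intro computable_intros assms)
  then show ?thesis by (simp add: minus_div_mult_eq_mod)
qed

lemma decidable_even [computable_intros]: "computable f \<Longrightarrow> decidable (\<lambda>x. even (f x))"
  unfolding even_iff_mod_2_eq_zero by (intro computable_intros)

lemma decidable_mem_set_decode [computable_intros]:
  "computable f \<Longrightarrow> computable g \<Longrightarrow> decidable (\<lambda>x. f x \<in> set_decode (g x))"
  unfolding set_decode_def mem_Collect_eq by (intro computable_intros)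

lemma computable_set_encode [computable_intros]:
  assumes "computable b" "decidable (\<lambda>y. P (fst (prod_decode y)) (snd (prod_decode y)))"
  shows "computable (\<lambda>x. set_encode {k. k < b x \<and> P x k})"
proof -
  have "computable (\<lambda>x. \<Sum>k<b x. of_bool (P x k) * 2 ^ k)"
    by (intro computable_intros assms)
  moreover have "(\<Sum>k<b x. of_bool (P x k) * 2 ^ k) = set_encode {k. k < b x \<and> P x k}" for x
    unfolding set_encode_def
    by (intro sum.mono_neutral_cong_right) auto
  ultimately show ?thesis by simp
qed

section \<open>Coded lists\<close>

definition list_code_drop :: "nat \<Rightarrow> nat \<Rightarrow> nat" where
  "list_code_drop n c = rec_nat c (\<lambda>_ r. snd (prod_decode (r - 1))) n"

definition list_code_nth :: "nat \<Rightarrow> nat \<Rightarrow> nat" where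
  "list_code_nth c n = fst (prod_decode (list_code_drop n c - 1))"

definition list_code_length :: "nat \<Rightarrow> nat" where
  "list_code_length c = (LEAST n. list_code_drop n c = 0)"

text \<open>The code of \<open>x # xs\<close> is the successor of a pair code, so predecessor
  followed by second projection removes the head. The empty list is fixed: its code 0 is its own
  truncated predecessor, and \<open>prod_decode 0 = (0, 0)\<close>.\<close>

lemma list_code_drop: "list_code_drop n (list_encode xs) = list_encode (drop n xs)"
proof (induction n)
  case (Suc n)
  have "list_code_drop (Suc n) (list_encode xs) = snd (prod_decode (list_encode (drop n xs) - 1))"
    using Suc by (simp add: list_code_drop_def)
  also have "\<dots> = list_encode (drop (Suc n) xs)"
  proof (cases "n < length xs")
    case True
    then show ?thesis by (simp add: Cons_nth_drop_Suc[symmetric])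
  next
    case False
    moreover have "prod_decode 0 = (0, 0)"
      using prod_encode_inverse[of "(0, 0)"] by (simp add: prod_encode_def)
    ultimately show ?thesis by simp
  qed
  finally show ?case .
qed (simp add: list_code_drop_def)

lemma list_code_nth: "n < length xs \<Longrightarrow> list_code_nth (list_encode xs) n = xs ! n"
  by (simp add: list_code_nth_def list_code_drop Cons_nth_drop_Suc[symmetric])

lemma list_encode_eq_0_iff: "list_encode xs = 0 \<longleftrightarrow> xs = []"
  by (cases xs) auto

lemma list_code_length: "list_code_length (list_encode xs) = length xs"
  unfolding list_code_length_def
  by (rule Least_equality) (auto simp: list_code_drop list_encode_eq_0_iff)

lemma computable_list_code_drop [computable_intros]:
  "computable f \<Longrightarrow> computable g \<Longrightarrow> computable (\<lambda>x. list_code_drop (f x) (g x))"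
  unfolding list_code_drop_def by (intro computable_intros)

lemma computable_list_code_nth [computable_intros]:
  "computable f \<Longrightarrow> computable g \<Longrightarrow> computable (\<lambda>x. list_code_nth (f x) (g x))"
  unfolding list_code_nth_def by (intro computable_intros)

lemma computable_list_code_length [computable_intros]:
  assumes "computable f"
  shows "computable (\<lambda>x. list_code_length (f x))"
proof -
  have "\<exists>n. list_code_drop n c = 0" for c
    by (rule exI[of _ "length (list_decode c)"])
       (metis list_code_drop list_decode_inverse drop_all le_refl list_encode.simps(1))
  then have "computable (\<lambda>c. list_code_length c)"
    unfolding list_code_length_def by (intro computable_intros)
  from computable_comp[OF this assms] show ?thesis .
qed

lemma computable_list_encode_map [computable_intros]:
  assumes "computable b" "computable (\<lambda>y. f (fst (prod_decode y)) (snd (prod_decode y)))"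
  shows "computable (\<lambda>x. list_encode (map (f x) [0..<b x]))"
proof -
  have f: "computable (\<lambda>y. f (u y) (v y))" if "computable u" "computable v" for u v
    using computable_comp[OF assms(2) computable_pair[OF that]] by simp
  have b: "computable (\<lambda>y. b (u y))" if "computable u" for u
    using computable_comp[OF assms(1) that] .
  \<comment> \<open>List codes grow at the front, so the recursion adds the entries from the last
    index down to 0.\<close>
  have "computable (\<lambda>x. rec_nat 0 (\<lambda>k r. Suc (prod_encode (f x (b x - Suc k), r))) (b x))"
    by (intro computable_intros f b)
  moreover have "rec_nat 0 (\<lambda>k r. Suc (prod_encode (f x (n - Suc k), r))) i
      = list_encode (map (f x) [n - i..<n])" if "i \<le> n" for x n i
    using that
  proof (induction i)
    case (Suc i)
    then have "[n - Suc i..<n] = (n - Suc i) # [n - i..<n]"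
      by (simp add: upt_conv_Cons Suc_diff_Suc)
    then show ?case using Suc by simp
  qed simp
  ultimately show ?thesis by simp
qed

section \<open>The cycle space of a graph\<close>

text \<open>A loop counts twice at its vertex, so that it is an even set by itself, just as it is a
  cycle of length 1.\<close>

definition deg :: "('e \<Rightarrow> 'v) \<Rightarrow> ('e \<Rightarrow> 'v) \<Rightarrow> 'e set \<Rightarrow> 'v \<Rightarrow> nat" where
  "deg a b T v = (\<Sum>e\<in>T. of_bool (a e = v) + of_bool (b e = v))"

text \<open>The binary cycle space of the graph in which the edge \<open>e\<close> has the ends
  \<open>a e\<close> and \<open>b e\<close>.\<close>

definition even_set :: "('e \<Rightarrow> 'v) \<Rightarrow> ('e \<Rightarrow> 'v) \<Rightarrow> 'e set \<Rightarrow> bool" where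
  "even_set a b T \<longleftrightarrow> finite T \<and> (\<forall>v. even (deg a b T v))"

text \<open>The odd vertices of \<open>P\<close> are \<open>u\<close> and \<open>w\<close>; for
  \<open>u = w\<close> the two indicators cancel modulo 2, leaving an even set.\<close>

definition joins :: "('e \<Rightarrow> 'v) \<Rightarrow> ('e \<Rightarrow> 'v) \<Rightarrow> 'e set \<Rightarrow> 'v \<Rightarrow> 'v \<Rightarrow> bool" where
  "joins a b P u w \<longleftrightarrow>
     finite P \<and> (\<forall>v. even (deg a b P v + of_bool (u = v) + of_bool (w = v)))"

definition trail :: "('e \<Rightarrow> 'v) \<Rightarrow> ('e \<Rightarrow> 'v) \<Rightarrow> (nat \<Rightarrow> 'v) \<Rightarrow> 'e list \<Rightarrow> bool" where
  "trail a b p es \<longleftrightarrow>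
     distinct es \<and> (\<forall>i<length es. {a (es ! i), b (es ! i)} = {p i, p (Suc i)})"

text \<open>The girth is phrased in the cycle space: nonempty even sets contain cycles and cycles
  are even sets, so this is the usual bound.\<close>

definition girth_ge :: "('e \<Rightarrow> 'v) \<Rightarrow> ('e \<Rightarrow> 'v) \<Rightarrow> 'e set \<Rightarrow> nat \<Rightarrow> bool" where
  "girth_ge a b E g \<longleftrightarrow> (\<forall>T\<subseteq>E. even_set a b T \<and> T \<noteq> {} \<longrightarrow> g \<le> card T)"

lemma even_deg_sym_diff:
  assumes "finite A" "finite B"
  shows "even (deg a b (sym_diff A B) v) \<longleftrightarrow> even (deg a b A v + deg a b B v)"
proof -
  have split: "deg a b X v = deg a b (X - Y) v + deg a b (X \<inter> Y) v" if "finite X" for X Y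
  proof -
    have "deg a b ((X - Y) \<union> (X \<inter> Y)) v = deg a b (X - Y) v + deg a b (X \<inter> Y) v"
      using that unfolding deg_def by (intro sum.union_disjoint) auto
    then show ?thesis by (simp add: Un_Diff_Int)
  qed
  have "deg a b (sym_diff A B) v = deg a b (A - B) v + deg a b (B - A) v"
    using assms unfolding deg_def by (intro sum.union_disjoint) auto
  moreover have "deg a b (B \<inter> A) v = deg a b (A \<inter> B) v"
    by (simp add: Int_commute)
  ultimately show ?thesis
    using split[OF assms(1), of B] split[OF assms(2), of A] by presburger
qed

lemma even_set_sym_diff:
  "even_set a b A \<Longrightarrow> even_set a b B \<Longrightarrow> even_set a b (sym_diff A B)"
  by (auto simp: even_set_def even_deg_sym_diff)

lemma joins_sym_diff:
  assumes "joins a b A u w" "joins a b B u w"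
  shows "even_set a b (sym_diff A B)"
  using assms unfolding joins_def even_set_def
  by (auto simp: even_deg_sym_diff)

lemma even_set_iff_joins: "even_set a b T \<longleftrightarrow> joins a b T u u"
  by (simp add: even_set_def joins_def)

lemma deg_insert:
  "finite T \<Longrightarrow> e \<notin> T \<Longrightarrow> deg a b (insert e T) v = of_bool (a e = v) + of_bool (b e = v) + deg a b T v"
  by (simp add: deg_def)

section \<open>Trails and cycles in even sets\<close>

lemma trail_take: "trail a b p es \<Longrightarrow> trail a b p (take k es)"
  by (simp add: trail_def)

lemma trail_joins:
  assumes "trail a b p es"
  shows "joins a b (set es) (p 0) (p (length es))"
  using assms
proof (induction es rule: rev_induct)
  case Nil
  then show ?case by (simp add: joins_def deg_def)
next
  case (snoc e es)
  from snoc.prems have ends: "{a e, b e} = {p (length es), p (Suc (length es))}"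
    unfolding trail_def by (metis length_append_singleton lessI nth_append_length)
  from snoc.prems have "e \<notin> set es" by (simp add: trail_def)
  have "trail a b p es"
    using trail_take[OF snoc.prems, of "length es"] by simp
  with snoc.IH have IH: "even (deg a b (set es) v + of_bool (p 0 = v) + of_bool (p (length es) = v))" for v
    by (simp add: joins_def)
  have "of_bool (a e = v) + of_bool (b e = v)
      = (of_bool (p (length es) = v) + of_bool (p (Suc (length es)) = v) :: nat)" for v
    using ends unfolding doubleton_eq_iff by (metis add.commute)
  then have "deg a b (set (es @ [e])) v = of_bool (p (length es) = v)
      + of_bool (p (Suc (length es)) = v) + deg a b (set es) v" for v
    using \<open>e \<notin> set es\<close> by (simp add: deg_insert)
  with IH show ?case
    unfolding joins_def by (simp add: algebra_simps)
qed

lemma trail_drop: "trail a b p es \<Longrightarrow> trail a b (\<lambda>i. p (i + k)) (drop k es)"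
  by (auto simp: trail_def add.commute)

lemma trail_snoc:
  assumes "trail a b p es" "f \<notin> set es" "{a f, b f} = {p (length es), w}"
  shows "trail a b (p(Suc (length es) := w)) (es @ [f])"
  using assms by (auto simp: trail_def nth_append less_Suc_eq)

lemma even_set_closed_trail:
  assumes T: "even_set a b T" "T \<noteq> {}"
  obtains p es where "es \<noteq> []" "set es \<subseteq> T" "trail a b p es" "p (length es) = p 0"
proof -
  obtain e where e: "e \<in> T" using T by blast
  have fin: "finite T" using T by (simp add: even_set_def)
  define P where "P = (\<lambda>(p, es). trail a b p es \<and> set es \<subseteq> T \<and> es \<noteq> [])"
  have "P (\<lambda>i. if i = 0 then a e else b e, [e])"
    using e by (auto simp: P_def trail_def)
  moreover have "\<forall>y. P y \<longrightarrow> length (snd y) < Suc (card T)"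
  proof (intro allI impI)
    fix y assume "P y"
    then have "distinct (snd y)" "set (snd y) \<subseteq> T" by (auto simp: P_def trail_def)
    then show "length (snd y) < Suc (card T)"
      using card_mono[OF fin] by (metis distinct_card less_Suc_eq_le)
  qed
  ultimately obtain x where x: "P x" "\<And>y. P y \<Longrightarrow> length (snd y) \<le> length (snd x)"
    using ex_has_greatest_nat[of P _ "\<lambda>y. length (snd y)"] by blast
  obtain p es where pe: "x = (p, es)" by fastforce
  from x(1) have tr: "trail a b p es" "set es \<subseteq> T" "es \<noteq> []" by (auto simp: P_def pe)
  let ?w = "p (length es)"
  have "?w = p 0"
  proof (rule ccontr)
    assume neq: "?w \<noteq> p 0"
    have "odd (deg a b (set es) ?w)"
      using trail_joins[OF tr(1)] neq unfolding joins_def by (auto dest: spec[of _ ?w])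
    moreover have "even (deg a b T ?w)" using T by (simp add: even_set_def)
    moreover have "sym_diff T (set es) = T - set es" using tr(2) by auto
    ultimately have "odd (deg a b (T - set es) ?w)"
      using even_deg_sym_diff[of T "set es" a b ?w] fin by simp
    then have "deg a b (T - set es) ?w \<noteq> 0" by (metis even_zero)
    then obtain f where f: "f \<in> T - set es"
      and "of_bool (a f = ?w) + of_bool (b f = ?w) \<noteq> (0 :: nat)"
      unfolding deg_def by (rule sum.not_neutral_contains_not_neutral)
    then have "a f = ?w \<or> b f = ?w" by auto
    then obtain w where "{a f, b f} = {?w, w}" by (metis insert_commute)
    with f tr have "P (p(Suc (length es) := w), es @ [f])"
      by (auto simp: P_def intro!: trail_snoc)
    from x(2)[OF this] show False by (simp add: pe)
  qed
  with tr that show ?thesis by blast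
qed

text \<open>A shortest closed trail in \<open>T\<close> is a cycle: the part between two visits to
  the same vertex would be a shorter closed trail.\<close>

lemma even_set_contains_cycle:
  assumes T: "even_set a b T" "T \<noteq> {}" and "T \<subseteq> edges G" and wf: "wf_mgraph G"
    and ends: "\<And>e. e \<in> edges G \<Longrightarrow> ends G e = {a e, b e}"
  shows "contains_cycle G T"
proof -
  define P where
    "P = (\<lambda>(p, es). es \<noteq> [] \<and> set es \<subseteq> T \<and> trail a b p es \<and> p (length es) = p 0)"
  obtain p0 es0 where "es0 \<noteq> []" "set es0 \<subseteq> T" "trail a b p0 es0" "p0 (length es0) = p0 0"
    using even_set_closed_trail[OF T] by blast
  then have "P (p0, es0)" by (simp add: P_def)
  then obtain x where x: "P x" "\<And>y. P y \<Longrightarrow> length (snd x) \<le> length (snd y)"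
    using ex_has_least_nat[of P _ "\<lambda>y. length (snd y)"] by blast
  obtain p es where pe: "x = (p, es)" by fastforce
  from x(1) have tr: "es \<noteq> []" "set es \<subseteq> T" "trail a b p es" "p (length es) = p 0"
    by (auto simp: P_def pe)
  have neq: "p i \<noteq> p j" if "i < j" "j < length es" for i j
  proof
    assume eq: "p i = p j"
    let ?es = "take (j - i) (drop i es)"
    have len: "length ?es = j - i" using that by simp
    have "trail a b (\<lambda>k. p (k + i)) ?es"
      by (intro trail_take trail_drop tr)
    moreover have "set ?es \<subseteq> T"
      using tr(2) by (meson order_trans set_drop_subset set_take_subset)
    moreover have "?es \<noteq> []" using len that by (metis list.size(3) zero_less_diff less_irrefl)
    moreover have "p (length ?es + i) = p (0 + i)" using len that eq by simp
    ultimately have "P (\<lambda>k. p (k + i), ?es)" by (simp add: P_def)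
    from x(2)[OF this] len that show False by (simp add: pe)
  qed
  have edge: "ends G (es ! i) = {p i, p (Suc i)}" "es ! i \<in> edges G" if "i < length es" for i
    using tr(2,3) that assms(3) ends unfolding trail_def by (metis nth_mem subsetD)+
  have "p i \<in> verts G" if "i < length es" for i
    using edge[OF that] wf unfolding wf_mgraph_def by auto
  moreover have "p (Suc i) = p (Suc i mod length es)" if "i < length es" for i
    using that tr(4) by (cases "Suc i = length es") auto
  moreover have "inj_on p {0..<length es}"
    by (intro linorder_inj_onI) (use neq in auto)
  ultimately have "is_cycle G (map p [0..<length es]) es"
    unfolding is_cycle_def using tr edge assms(3)
    by (auto simp: distinct_map trail_def)
  with tr show ?thesis unfolding contains_cycle_def by blast
qed

lemma is_cycle_even_set:
  assumes "is_cycle G vs es" and ends: "\<And>e. e \<in> edges G \<Longrightarrow> ends G e = {a e, b e}"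
  shows "even_set a b (set es)"
proof -
  \<comment> \<open>Reading the vertex list cyclically turns the cycle into a trail with
    \<open>?p (length es) = ?p 0\<close>.\<close>
  let ?p = "\<lambda>i. vs ! (i mod length es)"
  have "trail a b ?p es"
    unfolding trail_def
  proof (intro conjI allI impI)
    fix i assume "i < length es"
    with assms show "{a (es ! i), b (es ! i)} = {?p i, ?p (Suc i)}"
      unfolding is_cycle_def by (metis mod_less nth_mem subsetD)
  qed (use assms in \<open>simp add: is_cycle_def\<close>)
  from trail_joins[OF this] show ?thesis by (simp add: even_set_iff_joins[of _ _ _ "vs ! 0"])
qed

lemma contains_cycle_iff:
  assumes "wf_mgraph G" "\<And>e. e \<in> edges G \<Longrightarrow> ends G e = {a e, b e}" "S \<subseteq> edges G"
  shows "contains_cycle G S \<longleftrightarrow> (\<exists>T\<subseteq>S. T \<noteq> {} \<and> even_set a b T)"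
proof
  assume "contains_cycle G S"
  then obtain vs es where "is_cycle G vs es" "set es \<subseteq> S"
    by (auto simp: contains_cycle_def)
  with is_cycle_even_set[OF this(1) assms(2)] show "\<exists>T\<subseteq>S. T \<noteq> {} \<and> even_set a b T"
    by (auto simp: is_cycle_def)
next
  assume "\<exists>T\<subseteq>S. T \<noteq> {} \<and> even_set a b T"
  then obtain T where "T \<subseteq> S" "T \<noteq> {}" "even_set a b T" by blast
  with even_set_contains_cycle[of a b T G] assms have "contains_cycle G T" by blast
  with \<open>T \<subseteq> S\<close> show "contains_cycle G S" by (auto simp: contains_cycle_def)
qed

text \<open>An injective renaming keeps the degree of each vertex in \<open>V\<close>, and vertices
  outside \<open>V\<close> or its image meet no edge of \<open>T\<close>. This replaces the vertices
  of an arbitrary graph by numbers below \<open>2 * m\<close>.\<close>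

lemma even_set_inj:
  assumes "inj_on \<phi> V" "a ` T \<subseteq> V" "b ` T \<subseteq> V"
  shows "even_set (\<phi> \<circ> a) (\<phi> \<circ> b) T \<longleftrightarrow> even_set a b T"
proof -
  have 1: "deg (\<phi> \<circ> a) (\<phi> \<circ> b) T (\<phi> v) = deg a b T v" if "v \<in> V" for v
    unfolding deg_def using assms that
    by (intro sum.cong) (auto simp: inj_on_eq_iff[OF assms(1)] image_subset_iff)
  have 2: "deg (\<phi> \<circ> a) (\<phi> \<circ> b) T v = 0" if "v \<notin> \<phi> ` V" for v
    unfolding deg_def using assms that by (intro sum.neutral) auto
  have 3: "deg a b T v = 0" if "v \<notin> V" for v
    unfolding deg_def using assms that by (intro sum.neutral) auto
  show ?thesis
    unfolding even_set_def by (metis 1 2 3 even_zero imageE)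
qed

lemma even_set_cong:
  assumes "\<And>e. e \<in> T \<Longrightarrow> a e = a' e" "\<And>e. e \<in> T \<Longrightarrow> b e = b' e"
  shows "even_set a b T \<longleftrightarrow> even_set a' b' T"
  using assms by (simp add: even_set_def deg_def cong: sum.cong)

text \<open>Parity elimination: an even set with largest element \<open>e\<close> trades \<open>e\<close> for smaller edges.\<close>

lemma spanning_by_elimination:
  fixes B :: "nat set"
  assumes "\<And>e. e < m \<Longrightarrow> e \<notin> B \<Longrightarrow> \<exists>C. even_set a b C \<and> e \<in> C \<and> C \<subseteq> {..e}"
    and "T \<subseteq> {..<n}" "n \<le> m"
  shows "\<exists>T'. T' \<subseteq> B \<inter> {..<n} \<and> even_set a b (sym_diff T T')"
  using assms(2,3)
proof (induction n arbitrary: T)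
  case 0
  then show ?case by (intro exI[of _ "{}"]) (simp add: even_set_def deg_def)
next
  case (Suc n)
  have step: "\<exists>T'. T' \<subseteq> B \<inter> {..<n} \<and> even_set a b (sym_diff U T')" if "U \<subseteq> {..<n}" for U
    using Suc that by simp
  have sub: "U \<subseteq> {..<n}" if "U \<subseteq> {..<Suc n}" "n \<notin> U" for U
    using that by (auto simp: less_Suc_eq)
  show ?case
  proof (cases "n \<in> T")
    case False
    with step[OF sub[OF Suc.prems(1)]] obtain T'
      where "T' \<subseteq> B \<inter> {..<n}" "even_set a b (sym_diff T T')" by blast
    then show ?thesis by (intro exI[of _ T']) auto
  next
    case nT: True
    show ?thesis
    proof (cases "n \<in> B")
      case True
      from step[OF sub[of "T - {n}"]] Suc.prems(1) obtain T'
        where T': "T' \<subseteq> B \<inter> {..<n}" "even_set a b (sym_diff (T - {n}) T')" by auto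
      have "sym_diff T (insert n T') = sym_diff (T - {n}) T'"
        using nT T'(1) by auto
      with T'(2) have "even_set a b (sym_diff T (insert n T'))" by (simp only:)
      moreover have "insert n T' \<subseteq> B \<inter> {..<Suc n}" using T'(1) True by auto
      ultimately show ?thesis by blast
    next
      case False
      then obtain C where C: "even_set a b C" "n \<in> C" "C \<subseteq> {..n}"
        using assms(1)[of n] Suc.prems by auto
      have "sym_diff T C \<subseteq> {..<Suc n}" "n \<notin> sym_diff T C"
        using Suc.prems C nT by (auto simp: less_Suc_eq_le)
      from step[OF sub[OF this]] obtain T'
        where T': "T' \<subseteq> B \<inter> {..<n}" "even_set a b (sym_diff (sym_diff T C) T')" by auto
      have "sym_diff (sym_diff (sym_diff T C) T') C = sym_diff T T'" by auto
      with even_set_sym_diff[OF T'(2) C(1)] have "even_set a b (sym_diff T T')"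
        by (simp only:)
      moreover have "T' \<subseteq> B \<inter> {..<Suc n}" using T'(1) by auto
      ultimately show ?thesis by blast
    qed
  qed
qed

section \<open>Counting closed trails\<close>

text \<open>Two different joins of the same vertices would have a nonempty even symmetric difference
  with fewer than \<open>g\<close> edges.\<close>

lemma joins_unique:
  assumes "girth_ge a b E g" "P \<subseteq> E" "P' \<subseteq> E" "joins a b P u w" "joins a b P' u w"
    and "card P + card P' < g"
  shows "P = P'"
proof (rule ccontr)
  assume "P \<noteq> P'"
  then have "sym_diff P P' \<noteq> {}" by auto
  moreover have "even_set a b (sym_diff P P')"
    by (rule joins_sym_diff[OF assms(4,5)])
  moreover have "sym_diff P P' \<subseteq> E" using assms by auto
  ultimately have "g \<le> card (sym_diff P P')"
    using assms(1) unfolding girth_ge_def by blast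
  also have "\<dots> \<le> card (P - P') + card (P' - P)" by (rule card_Un_le)
  also have "\<dots> \<le> card P + card P'"
    using assms(4,5) by (intro add_mono card_mono) (auto simp: joins_def)
  finally show False using assms(6) by simp
qed

definition short_links :: "(nat \<Rightarrow> nat) \<Rightarrow> (nat \<Rightarrow> nat) \<Rightarrow> nat set \<Rightarrow> nat \<Rightarrow> nat \<Rightarrow> nat set set" where
  "short_links a b E M k = {P. P \<subseteq> E \<and> card P < k \<and> (\<exists>u<M. \<exists>w<M. joins a b P u w)}"

text \<open>Each link has at most \<open>k - 1\<close> edges, so two of them together have fewer
  than \<open>g\<close>. By \<open>joins_unique\<close> a link is determined by its pair of
  ends.\<close>

lemma card_short_links:
  assumes "girth_ge a b E g" "2 * k < g + 2"
  shows "finite (short_links a b E M k)" "card (short_links a b E M k) \<le> M * M"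
proof -
  define f where "f = (\<lambda>P. SOME uw. fst uw < M \<and> snd uw < M \<and> joins a b P (fst uw) (snd uw))"
  have f: "fst (f P) < M \<and> snd (f P) < M \<and> joins a b P (fst (f P)) (snd (f P))"
    if "P \<in> short_links a b E M k" for P
  proof -
    have "\<exists>uw. fst uw < M \<and> snd uw < M \<and> joins a b P (fst uw) (snd uw)"
      using that unfolding short_links_def by auto
    then show ?thesis unfolding f_def by (rule someI_ex)
  qed
  have inj: "inj_on f (short_links a b E M k)"
  proof (rule inj_onI)
    fix P P' assume P: "P \<in> short_links a b E M k" "P' \<in> short_links a b E M k" "f P = f P'"
    have "card P + card P' < g"
      using P assms(2) by (auto simp: short_links_def)
    moreover have "P \<subseteq> E" "P' \<subseteq> E" using P by (auto simp: short_links_def)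
    ultimately show "P = P'"
      using joins_unique[OF assms(1)] f[OF P(1)] f[OF P(2)] P(3) by metis
  qed
  have sub: "f ` short_links a b E M k \<subseteq> {..<M} \<times> {..<M}"
    by (intro image_subsetI) (simp add: mem_Times_iff f)
  show "finite (short_links a b E M k)"
    using inj sub by (meson finite_SigmaI finite_lessThan inj_on_finite)
  show "card (short_links a b E M k) \<le> M * M"
    using card_inj_on_le[OF inj sub] by simp
qed

text \<open>A chunk is a free edge followed by a link, which gives pieces of up to \<open>k\<close>
  edges even when the girth is so small that all links are empty. The chunk \<open>{}\<close> pads
  trails that need fewer pieces.\<close>

definition chunks :: "(nat \<Rightarrow> nat) \<Rightarrow> (nat \<Rightarrow> nat) \<Rightarrow> nat set \<Rightarrow> nat \<Rightarrow> nat \<Rightarrow> nat set set" where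
  "chunks a b E M k = insert {} ((\<lambda>(e, P). insert e P) ` (E \<times> short_links a b E M k))"

lemma card_chunks:
  assumes "girth_ge a b E g" "2 * k < g + 2" "finite E"
  shows "finite (chunks a b E M k)" "card (chunks a b E M k) \<le> Suc (card E * (M * M))"
proof -
  note sl = card_short_links[OF assms(1,2), of M]
  show "finite (chunks a b E M k)"
    unfolding chunks_def using sl assms(3) by auto
  let ?I = "(\<lambda>(e, P). insert e P) ` (E \<times> short_links a b E M k)"
  have "card (chunks a b E M k) \<le> Suc (card ?I)"
    unfolding chunks_def using sl(1) assms(3) by (simp add: card_insert_if)
  moreover have "card ?I \<le> card (E \<times> short_links a b E M k)"
    using sl assms(3) by (intro card_image_le) auto
  moreover have "card (E \<times> short_links a b E M k) \<le> card E * (M * M)"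
    using sl by (simp add: card_cartesian_product)
  ultimately show "card (chunks a b E M k) \<le> Suc (card E * (M * M))" by linarith
qed

lemma trail_vertex_less:
  assumes "trail a b p es" "es \<noteq> []" "i \<le> length es"
    and "\<And>e. e \<in> set es \<Longrightarrow> a e < M \<and> b e < M"
  shows "p i < M"
proof -
  obtain j where j: "j < length es" "i = j \<or> i = Suc j"
    using assms(2,3) by (cases "i = length es") (auto intro: that[of "length es - 1"] that[of i])
  have "p i \<in> {a (es ! j), b (es ! j)}"
    using j assms(1) unfolding trail_def by blast
  with assms(4)[of "es ! j"] j show ?thesis by auto
qed

text \<open>Induction on the number of pieces: the first \<open>k\<close> edges form a chunk, and
  the rest is again a trail, with its vertices shifted by \<open>k\<close>.\<close>

lemma trail_Union_chunks:
  assumes "trail a b p es" "set es \<subseteq> E" "length es \<le> r * k"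
    and "\<And>e. e \<in> E \<Longrightarrow> a e < M \<and> b e < M"
  shows "\<exists>L. length L = r \<and> set L \<subseteq> chunks a b E M k \<and> set es = \<Union>(set L)"
  using assms(1-3)
proof (induction r arbitrary: p es)
  case 0
  then show ?case by simp
next
  case (Suc r)
  show ?case
  proof (cases es)
    case Nil
    then show ?thesis
      by (intro exI[of _ "replicate (Suc r) {}"]) (auto simp: chunks_def)
  next
    case (Cons e es')
    have "0 < k" using Suc.prems Cons by (cases k) auto
    have len: "length (drop k es) \<le> r * k" using Suc.prems by simp
    have "set (drop k es) \<subseteq> E" using Suc.prems set_drop_subset by fastforce
    from Suc.IH[OF trail_drop[OF Suc.prems(1)] this len] obtain L where
      L: "length L = r" "set L \<subseteq> chunks a b E M k" "set (drop k es) = \<Union>(set L)" by auto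
    \<comment> \<open>After the first edge \<open>e\<close>, the piece is a trail from
      \<open>p 1\<close> with at most \<open>k - 1\<close> edges, hence a link.\<close>
    define P where "P = set (take (k - 1) es')"
    have take: "set (take k es) = insert e P"
      using \<open>0 < k\<close> by (simp add: Cons P_def take_Cons')
    have tr: "trail a b (\<lambda>i. p (i + 1)) (take (k - 1) es')"
      using trail_take[OF trail_drop[OF Suc.prems(1), of 1], of "k - 1"] by (simp add: Cons)
    have lt: "p i < M" if "i \<le> length es" for i
      using trail_vertex_less[OF Suc.prems(1) _ that, of M] assms(4) Suc.prems(2) Cons by blast
    have "joins a b P (p 1) (p (length (take (k - 1) es') + 1))"
      using trail_joins[OF tr] by (simp add: P_def)
    moreover have "p 1 < M" "p (length (take (k - 1) es') + 1) < M"
      by (rule lt; simp add: Cons)+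
    moreover have "P \<subseteq> E"
      using Suc.prems(2) set_take_subset[of "k - 1" es'] by (auto simp: P_def Cons)
    moreover have "card P < k"
      using card_length[of "take (k - 1) es'"] \<open>0 < k\<close> unfolding P_def length_take by linarith
    ultimately have "P \<in> short_links a b E M k"
      unfolding short_links_def by blast
    moreover have "e \<in> E" using Suc.prems(2) by (simp add: Cons)
    ultimately have "insert e P \<in> chunks a b E M k"
      unfolding chunks_def by auto
    moreover have "set es = set (take k es) \<union> set (drop k es)"
      by (metis append_take_drop_id set_append)
    ultimately show ?thesis
      using L take by (intro exI[of _ "insert e P # L"]) auto
  qed
qed

section \<open>Closed trails as edge sets\<close>

definition closed_trails :: "(nat \<Rightarrow> nat) \<Rightarrow> (nat \<Rightarrow> nat) \<Rightarrow> nat set \<Rightarrow> nat set set" where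
  "closed_trails a b E =
     {T. T \<subseteq> E \<and> (\<exists>p es. es \<noteq> [] \<and> T = set es \<and> trail a b p es \<and> p (length es) = p 0)}"

text \<open>Cut a closed trail into pieces of about half the girth: apart from its first edge, each piece is
  determined by its two end vertices.\<close>

lemma card_closed_trails:
  assumes "girth_ge a b E g" "2 * k < g + 2" "finite E"
    and "\<And>e. e \<in> E \<Longrightarrow> a e < M \<and> b e < M"
  shows "card {T \<in> closed_trails a b E. card T \<le> r * k} \<le> Suc (card E * (M * M)) ^ r"
proof -
  let ?L = "{L. set L \<subseteq> chunks a b E M k \<and> length L = r}"
  note ch = card_chunks[OF assms(1-3), of M]
  have "{T \<in> closed_trails a b E. card T \<le> r * k} \<subseteq> (\<lambda>L. \<Union>(set L)) ` ?L"
  proof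
    fix T assume T: "T \<in> {T \<in> closed_trails a b E. card T \<le> r * k}"
    then obtain p es where es: "T = set es" "trail a b p es" "T \<subseteq> E"
      by (auto simp: closed_trails_def)
    then have "length es \<le> r * k"
      using T by (simp add: trail_def distinct_card)
    moreover have "set es \<subseteq> E" using es by simp
    ultimately obtain L where "length L = r" "set L \<subseteq> chunks a b E M k" "set es = \<Union>(set L)"
      using trail_Union_chunks[OF es(2), of E r k M] assms(4) by blast
    with es(1) show "T \<in> (\<lambda>L. \<Union>(set L)) ` ?L" by blast
  qed
  moreover have "finite ?L" using ch(1) by (rule finite_lists_length_eq)
  ultimately have "card {T \<in> closed_trails a b E. card T \<le> r * k} \<le> card ?L"
    by (meson card_image_le card_mono finite_imageI le_trans)
  also have "\<dots> = card (chunks a b E M k) ^ r" using ch(1) by (rule card_lists_length_eq)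
  also have "\<dots> \<le> Suc (card E * (M * M)) ^ r" using ch(2) by (rule power_mono) simp
  finally show ?thesis .
qed

lemma closed_trails_even_set:
  assumes "T \<in> closed_trails a b E"
  shows "even_set a b T" "T \<noteq> {}" "T \<subseteq> E"
proof -
  obtain p es where es: "es \<noteq> []" "T = set es" "trail a b p es" "p (length es) = p 0"
    using assms unfolding closed_trails_def by blast
  show "even_set a b T"
    using trail_joins[OF es(3)] es by (simp add: even_set_iff_joins[of _ _ _ "p 0"])
  show "T \<noteq> {}" "T \<subseteq> E" using es assms by (auto simp: closed_trails_def)
qed

text \<open>The edge \<open>x\<close> makes \<open>sym_diff T C\<close> nonempty, so
  \<open>card (T - C) + card (C - T)\<close> is at least \<open>g\<close>, and so is
  \<open>card T = card (T - C) + card (T \<inter> C)\<close>. Adding both gives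
  \<open>2 * g \<le> 2 * card (T - C) + card C\<close>, where \<open>card C\<close> is at most
  \<open>3 * g / 2\<close>.\<close>

lemma card_diff_short_cycle:
  assumes "girth_ge a b E g" "T \<in> closed_trails a b E" "C \<subseteq> E" "even_set a b C" "x \<in> C" "x \<notin> T"
    "2 * card C \<le> 3 * g"
  shows "g \<le> 4 * card (T - C)" "card T \<le> card (T - C) + card C"
proof -
  note T = closed_trails_even_set[OF assms(2)]
  have fin: "finite T" "finite C" using T assms(4) by (auto simp: even_set_def)
  have "sym_diff T C \<subseteq> E" "sym_diff T C \<noteq> {}" using T(3) assms(3,5,6) by auto
  then have "g \<le> card (sym_diff T C)"
    using assms(1)[unfolded girth_ge_def, rule_format, of "sym_diff T C"]
      even_set_sym_diff[OF T(1) assms(4)] by simp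
  also have "\<dots> \<le> card (T - C) + card (C - T)" by (rule card_Un_le)
  finally have 1: "g \<le> card (T - C) + card (C - T)" .
  have 2: "g \<le> card T" using assms(1) T unfolding girth_ge_def by blast
  have 3: "card T = card (T - C) + card (T \<inter> C)"
    using fin by (metis card_Diff_subset_Int card_mono Int_lower1 finite_Int le_add_diff_inverse2)
  have 4: "card C = card (C - T) + card (T \<inter> C)"
    using fin by (metis Int_commute card_Diff_subset_Int card_mono Int_lower1 finite_Int le_add_diff_inverse2)
  from 1 2 3 4 assms(7) show "g \<le> 4 * card (T - C)" by linarith
  from 3 4 show "card T \<le> card (T - C) + card C" by linarith
qed

section \<open>Random edge sets\<close>

text \<open>The probability of \<open>S\<close> when each of the \<open>m\<close> edges is drawn
  independently with probability \<open>p\<close>.\<close>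

definition wt :: "nat \<Rightarrow> real \<Rightarrow> nat set \<Rightarrow> real" where
  "wt m p S = p ^ card S * (1 - p) ^ card ({..<m} - S)"

lemma sum_wt_supersets:
  assumes "A \<subseteq> {..<m}"
  shows "(\<Sum>S\<in>{S\<in>Pow {..<m}. A \<subseteq> S}. wt m p S) = p ^ card A"
proof -
  \<comment> \<open>Expanding the product of all \<open>p + ?g x\<close> gives a sum over subsets.
    Since \<open>?g\<close> vanishes on \<open>A\<close>, only supersets of \<open>A\<close>
    contribute; outside \<open>A\<close> the factors are \<open>p + (1 - p) = 1\<close>.\<close>
  let ?g = "\<lambda>x. if x \<in> A then 0 else 1 - p"
  have "p ^ card A = (\<Prod>x<m. if x \<in> A then p else 1)"
    using assms by (simp add: prod.If_cases Int_absorb1)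
  also have "\<dots> = (\<Prod>x<m. p + ?g x)" by (intro prod.cong) auto
  also have "\<dots> = (\<Sum>S\<in>Pow {..<m}. (\<Prod>x\<in>S. p) * (\<Prod>x\<in>{..<m} - S. ?g x))"
    by (rule prod_add) simp
  also have "\<dots> = (\<Sum>S\<in>{S\<in>Pow {..<m}. A \<subseteq> S}. wt m p S)"
  proof (intro sum.mono_neutral_cong_right ballI)
    fix S assume "S \<in> Pow {..<m} - {S \<in> Pow {..<m}. A \<subseteq> S}"
    then obtain x where "x \<in> A" "x \<in> {..<m} - S" using assms by auto
    then have "(\<Prod>x\<in>{..<m} - S. ?g x) = 0" by (intro prod_zero) auto
    then show "(\<Prod>x\<in>S. p) * (\<Prod>x\<in>{..<m} - S. ?g x) = 0" by simp
  next
    fix S assume "S \<in> {S \<in> Pow {..<m}. A \<subseteq> S}"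
    then have "(\<Prod>x\<in>{..<m} - S. ?g x) = (\<Prod>x\<in>{..<m} - S. 1 - p)"
      by (intro prod.cong) auto
    then show "(\<Prod>x\<in>S. p) * (\<Prod>x\<in>{..<m} - S. ?g x) = wt m p S" by (simp add: wt_def)
  qed auto
  finally show ?thesis by simp
qed

text \<open>Averaging: if each target is hit with probability at least \<open>\<delta>\<close>, some
  single set hits at least that fraction of the targets still missed. Repeating this shrinks what is
  missed geometrically.\<close>

lemma greedy_cover:
  fixes w :: "'s \<Rightarrow> real"
  assumes "finite X" "finite \<Omega>" "\<And>S. S \<in> \<Omega> \<Longrightarrow> 0 \<le> w S" "sum w \<Omega> = 1" "\<delta> \<le> 1"
    and hit: "\<And>x. x \<in> X \<Longrightarrow> \<delta> \<le> (\<Sum>S\<in>{S\<in>\<Omega>. R S x}. w S)"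
  shows "\<exists>F. (\<forall>j. F j \<in> \<Omega>) \<and> real (card {x\<in>X. \<forall>j<n. \<not> R (F j) x}) \<le> (1 - \<delta>) ^ n * card X"
proof (induction n)
  case 0
  have "\<Omega> \<noteq> {}" using assms(4) by auto
  then obtain S where "S \<in> \<Omega>" by blast
  then show ?case by (intro exI[of _ "\<lambda>_. S"]) simp
next
  case (Suc n)
  then obtain F where F: "\<And>j. F j \<in> \<Omega>"
    and IH: "real (card {x\<in>X. \<forall>j<n. \<not> R (F j) x}) \<le> (1 - \<delta>) ^ n * card X" by blast
  define Y where "Y = {x\<in>X. \<forall>j<n. \<not> R (F j) x}"
  have finY: "finite Y" and YX: "Y \<subseteq> X" using assms(1) by (auto simp: Y_def)
  let ?c = "\<lambda>S. card {x\<in>Y. \<not> R S x}"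
  have "\<Omega> \<noteq> {}" using assms(4) by auto
  then obtain S where S: "S \<in> \<Omega>" "\<And>S'. S' \<in> \<Omega> \<Longrightarrow> ?c S \<le> ?c S'"
    using ex_has_least_nat[of "\<lambda>S. S \<in> \<Omega>" _ ?c] by blast
  have "real (?c S) = (\<Sum>S'\<in>\<Omega>. w S' * ?c S)"
    using assms(4) by (simp add: sum_distrib_right[symmetric])
  also have "\<dots> \<le> (\<Sum>S'\<in>\<Omega>. w S' * ?c S')"
    using assms(3) S(2) by (intro sum_mono mult_left_mono) auto
  also have "\<dots> = (\<Sum>S'\<in>\<Omega>. \<Sum>x\<in>Y. if R S' x then 0 else w S')"
  proof (rule sum.cong)
    fix S'
    have "(\<Sum>x\<in>Y. if R S' x then 0 else w S') = (\<Sum>x\<in>{x\<in>Y. \<not> R S' x}. w S')"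
      using finY by (intro sum.mono_neutral_cong_right) auto
    then show "w S' * real (?c S') = (\<Sum>x\<in>Y. if R S' x then 0 else w S')"
      by (simp add: mult.commute)
  qed simp
  also have "\<dots> = (\<Sum>x\<in>Y. \<Sum>S'\<in>\<Omega>. if R S' x then 0 else w S')" by (rule sum.swap)
  also have "\<dots> \<le> (\<Sum>x\<in>Y. 1 - \<delta>)"
  proof (rule sum_mono)
    fix x assume x: "x \<in> Y"
    have "(\<Sum>S'\<in>\<Omega>. if R S' x then 0 else w S') = (\<Sum>S'\<in>\<Omega>. w S' - (if R S' x then w S' else 0))"
      by (intro sum.cong) auto
    also have "\<dots> = 1 - (\<Sum>S'\<in>\<Omega>. if R S' x then w S' else 0)"
      by (simp add: sum_subtractf assms(4))
    also have "(\<Sum>S'\<in>\<Omega>. if R S' x then w S' else 0) = (\<Sum>S\<in>{S\<in>\<Omega>. R S x}. w S)"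
      using assms(2) by (intro sum.mono_neutral_cong_right) auto
    finally show "(\<Sum>S'\<in>\<Omega>. if R S' x then 0 else w S') \<le> 1 - \<delta>"
      using hit[of x] x YX by auto
  qed
  also have "\<dots> = (1 - \<delta>) * card Y" by simp
  also have "\<dots> \<le> (1 - \<delta>) * ((1 - \<delta>) ^ n * card X)"
    using IH assms(5) by (intro mult_left_mono) (auto simp: Y_def)
  finally have *: "real (?c S) \<le> (1 - \<delta>) ^ Suc n * card X" by simp
  have "{x\<in>X. \<forall>j<Suc n. \<not> R ((F(n := S)) j) x} = {x\<in>Y. \<not> R S x}"
    by (auto simp: Y_def less_Suc_eq)
  with * F S(1) show ?case by (intro exI[of _ "F(n := S)"]) auto
qed

text \<open>If \<open>C \<subseteq> E\<close> and \<open>x\<close> is the largest edge of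
  \<open>C\<close>, such an \<open>S\<close> exposes \<open>x\<close>: the part of
  \<open>E \<inter> S\<close> below \<open>x\<close> is independent, while the part up to
  \<open>x\<close> contains \<open>C\<close>.\<close>

definition isolates :: "(nat \<Rightarrow> nat) \<Rightarrow> (nat \<Rightarrow> nat) \<Rightarrow> nat set \<Rightarrow> nat set \<Rightarrow> nat \<Rightarrow> nat set \<Rightarrow> bool" where
  "isolates a b E C x S \<longleftrightarrow> C \<subseteq> S \<and> (\<forall>T\<subseteq>E \<inter> S. even_set a b T \<and> T \<noteq> {} \<longrightarrow> x \<in> T)"

text \<open>The exponent 62: at most \<open>Q ^ (3 * r)\<close> closed trails with \<open>r \<le> 14 * t / g + 1\<close> have \<open>t\<close> edges outside
  \<open>C\<close>, where \<open>g \<le> 4 * t\<close>, and \<open>3 * (14 * t / g + 1) - 62 * t / g \<le> - 2\<close> makes their total weight at most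
  \<open>1 / Q\<^sup>2\<close> for each \<open>t\<close>.\<close>

context
  fixes a b :: "nat \<Rightarrow> nat" and E C :: "nat set" and m g x :: nat and Q p :: real
  assumes E: "E \<subseteq> {..<m}" and ends: "\<And>e. e \<in> E \<Longrightarrow> a e < 2 * m \<and> b e < 2 * m"
    and girth: "girth_ge a b E g" and g: "0 < g"
    and C: "C \<subseteq> E" "even_set a b C" "x \<in> C" "2 * card C \<le> 3 * g"
  defines "Q \<equiv> real (2 * m + 1)" and "p \<equiv> Q powr (- 62 / g)"
begin

lemma Q_gt_1: "1 < Q"
  using C E by (auto simp: Q_def)

lemma p_pos: "0 < p" and p_le_1: "p \<le> 1"
proof -
  show "0 < p" using Q_gt_1 by (simp add: p_def)
  show "p \<le> 1" using Q_gt_1 powr_mono[of "- 62 / g" 0 Q] by (simp add: p_def)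
qed

lemma p_power: "p ^ n = Q powr (- 62 * real n / g)"
  using Q_gt_1 by (simp add: p_def powr_realpow[symmetric] powr_powr)

lemma finite_E: "finite E" and card_E: "card E \<le> m"
  using E finite_subset card_mono[OF _ E] by auto

lemma finite_closed_trails: "finite (closed_trails a b E)"
  by (rule finite_subset[of _ "Pow E"]) (auto simp: closed_trails_def finite_E)

lemma sum_avoiding_trails_of_excess:
  "(\<Sum>T\<in>{T \<in> {T \<in> closed_trails a b E. x \<notin> T}. card (T - C) = t}. p ^ card (T - C)) \<le> 1 / Q\<^sup>2"
    (is "sum _ ?A \<le> _")
proof (cases "?A = {}")
  case True
  show ?thesis unfolding True by simp
next
  case False
  then have "g \<le> 4 * t"
    using card_diff_short_cycle(1)[OF girth _ C(1,2,3) _ C(4)] by auto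
  define k where "k = (g + 1) div 2"
  define r where "r = (14 * t) div g + 1"
  have "14 * t \<le> r * g"
    using g unfolding r_def by (metis add.commute less_imp_le dividend_less_div_times mult.commute
      distrib_right mult_1)
  also have "\<dots> \<le> r * (2 * k)" by (intro mult_left_mono) (auto simp: k_def)
  finally have rk: "7 * t \<le> r * k" by (simp add: mult_ac)
  have "?A \<subseteq> {T \<in> closed_trails a b E. card T \<le> r * k}"
  proof
    fix T assume T: "T \<in> ?A"
    then have "card T \<le> t + card C"
      using card_diff_short_cycle(2)[OF girth _ C(1,2,3) _ C(4)] by auto
    with T rk \<open>g \<le> 4 * t\<close> C(4) show "T \<in> {T \<in> closed_trails a b E. card T \<le> r * k}" by simp
  qed
  moreover have "finite (closed_trails a b E)"
    by (rule finite_closed_trails)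
  ultimately have "card ?A \<le> card {T \<in> closed_trails a b E. card T \<le> r * k}"
    by (intro card_mono) auto
  also have "\<dots> \<le> Suc (card E * (2 * m * (2 * m))) ^ r"
    using ends finite_E girth by (intro card_closed_trails[where g = g]) (auto simp: k_def)
  also have "\<dots> \<le> ((2 * m + 1) ^ 3) ^ r"
  proof (rule power_mono)
    have "card E * (2 * m * (2 * m)) \<le> m * (2 * m * (2 * m))"
      using card_E by (rule mult_right_mono) simp
    moreover have "Suc (m * (2 * m * (2 * m))) \<le> (2 * m + 1) ^ 3"
      by (simp add: power3_eq_cube algebra_simps)
    ultimately show "Suc (card E * (2 * m * (2 * m))) \<le> (2 * m + 1) ^ 3" by linarith
  qed simp
  finally have "real (card ?A) \<le> real (((2 * m + 1) ^ 3) ^ r)" by (simp only: of_nat_le_iff)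
  also have "\<dots> = Q powr (3 * r)"
    using Q_gt_1 by (simp add: Q_def powr_realpow[symmetric] power_mult[symmetric])
  finally have card: "real (card ?A) \<le> Q powr (3 * r)" .
  have "real (14 * t div g) \<le> real (14 * t) / g" by (rule of_nat_div_le_of_nat)
  then have "real r \<le> 14 * (t / g) + 1" by (simp add: r_def)
  moreover have "1 \<le> 4 * (real t / g)"
    using \<open>g \<le> 4 * t\<close> g by (simp add: field_simps)
  \<comment> \<open>The left side is at most \<open>3 - 20 * t / g\<close>, and \<open>t / g\<close>
    is at least \<open>1 / 4\<close>.\<close>
  ultimately have "3 * real r + (- 62 * (real t / g)) \<le> - 2" by linarith
  then have expo: "real (3 * r) + (- 62 * real t / g) \<le> - 2" by simp
  have "(\<Sum>T\<in>?A. p ^ card (T - C)) = card ?A * p ^ t" by simp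
  also have "\<dots> \<le> Q powr (3 * r) * Q powr (- 62 * real t / g)"
    using card p_pos unfolding p_power[symmetric] by (intro mult_right_mono) auto
  also have "\<dots> = Q powr (3 * r + (- 62 * real t / g))" by (rule powr_add[symmetric])
  also have "\<dots> \<le> Q powr (- 2)"
    using expo Q_gt_1 by (intro powr_mono) auto
  also have "\<dots> = 1 / Q\<^sup>2"
    using Q_gt_1 by (simp add: powr_minus_divide)
  finally show ?thesis .
qed

text \<open>Group the trails by their excess \<open>t\<close>. It lies between 1 and
  \<open>m\<close>, because \<open>0 < g \<le> 4 * t\<close>, and \<open>m\<close> groups of weight
  at most \<open>1 / Q\<^sup>2\<close> add up to at most \<open>1 / 2\<close>, as
  \<open>2 * m < Q\<close>.\<close>

lemma sum_avoiding_trails: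
  "(\<Sum>T\<in>{T \<in> closed_trails a b E. x \<notin> T}. p ^ card (T - C)) \<le> 1 / 2"
proof -
  let ?T = "{T \<in> closed_trails a b E. x \<notin> T}"
  have fin: "finite ?T"
    using finite_closed_trails by simp
  have "card (T - C) \<in> {1..m}" if T: "T \<in> ?T" for T
  proof -
    have "T - C \<subseteq> E" using T by (auto simp: closed_trails_def)
    then have "card (T - C) \<le> m" using finite_E card_E card_mono le_trans by blast
    moreover have "g \<le> 4 * card (T - C)"
      using T card_diff_short_cycle(1)[OF girth _ C(1,2,3) _ C(4)] by auto
    ultimately show ?thesis using g by auto
  qed
  then have "(\<Sum>T\<in>?T. p ^ card (T - C)) = (\<Sum>t\<in>{1..m}. \<Sum>T\<in>{T \<in> ?T. card (T - C) = t}. p ^ card (T - C))"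
    using fin by (intro sum.group[symmetric]) auto
  also have "\<dots> \<le> (\<Sum>t\<in>{1..m}. 1 / Q\<^sup>2)"
    by (intro sum_mono sum_avoiding_trails_of_excess)
  also have "\<dots> = m / Q\<^sup>2" by simp
  also have "\<dots> \<le> 1 / 2"
  proof -
    have "2 * real m \<le> Q * 1" by (simp add: Q_def)
    also have "\<dots> \<le> Q * Q" using Q_gt_1 by (intro mult_left_mono) auto
    finally show ?thesis using Q_gt_1 by (simp add: field_simps power2_eq_square)
  qed
  finally show ?thesis .
qed

text \<open>Union bound: a superset \<open>S\<close> of \<open>C\<close> fails only if it also
  contains a closed trail \<open>T\<close> avoiding \<open>x\<close>, an event of weight
  \<open>p ^ card C * p ^ card (T - C)\<close>. Summed over \<open>T\<close> this is at most half of
  the weight \<open>p ^ card C\<close> of all supersets of \<open>C\<close>.\<close>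

lemma isolating_weight:
  "1 / (2 * Q ^ 93) \<le> (\<Sum>S\<in>{S\<in>Pow {..<m}. isolates a b E C x S}. wt m p S)"
proof -
  let ?T = "{T \<in> closed_trails a b E. x \<notin> T}" and ?P = "Pow {..<m} :: nat set set"
  have finT: "finite ?T"
    using finite_closed_trails by simp
  have wt0: "0 \<le> wt m p S" for S using p_pos p_le_1 by (simp add: wt_def)
  have finC: "finite C" using C(1) finite_E finite_subset by blast
  have pw: "(\<Sum>S\<in>?P. if C \<subseteq> S then wt m p S else 0)
    \<le> (\<Sum>S\<in>?P. (if isolates a b E C x S then wt m p S else 0)
              + (\<Sum>T\<in>?T. if C \<union> T \<subseteq> S then wt m p S else 0))"
  proof (rule sum_mono)
    fix S
    have nn: "0 \<le> (\<Sum>T\<in>?T. if C \<union> T \<subseteq> S then wt m p S else 0)"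
      using wt0 by (intro sum_nonneg) auto
    show "(if C \<subseteq> S then wt m p S else 0) \<le> (if isolates a b E C x S then wt m p S else 0)
              + (\<Sum>T\<in>?T. if C \<union> T \<subseteq> S then wt m p S else 0)"
    proof (cases "C \<subseteq> S \<and> \<not> isolates a b E C x S")
      case True
      then obtain T where T: "T \<subseteq> E \<inter> S" "even_set a b T" "T \<noteq> {}" "x \<notin> T"
        unfolding isolates_def by blast
      \<comment> \<open>The union bound runs over closed trails, which can be counted, rather than
        over all even sets.\<close>
      obtain q es where es: "es \<noteq> []" "set es \<subseteq> T" "trail a b q es" "q (length es) = q 0"
        using even_set_closed_trail[OF T(2,3)] by blast
      have mem: "set es \<in> ?T" using es T unfolding closed_trails_def by blast
      have "C \<union> set es \<subseteq> S" using True es T by auto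
      then have "wt m p S = (if C \<union> set es \<subseteq> S then wt m p S else 0)" by simp
      also have "\<dots> \<le> (\<Sum>T\<in>?T. if C \<union> T \<subseteq> S then wt m p S else 0)"
        using wt0 finT mem by (intro member_le_sum) auto
      finally show ?thesis using True by simp
    next
      case False
      with nn wt0 show ?thesis by auto
    qed
  qed
  have sup: "(\<Sum>S\<in>?P. if A \<subseteq> S then wt m p S else 0) = p ^ card A" if "A \<subseteq> {..<m}" for A
  proof -
    have "(\<Sum>S\<in>?P. if A \<subseteq> S then wt m p S else 0) = (\<Sum>S\<in>{S\<in>?P. A \<subseteq> S}. wt m p S)"
      by (intro sum.mono_neutral_cong_right) auto
    with sum_wt_supersets[OF that] show ?thesis by simp
  qed
  have CT: "p ^ card (C \<union> T) = p ^ card C * p ^ card (T - C)" "C \<union> T \<subseteq> {..<m}" if "T \<in> ?T" for T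
  proof -
    have "T \<subseteq> E" using that by (auto simp: closed_trails_def)
    moreover then have "finite T" using finite_E finite_subset by blast
    moreover have "C \<union> T = C \<union> (T - C)" by auto
    ultimately have "card (C \<union> T) = card C + card (T - C)"
      using finC by (metis Diff_disjoint card_Un_disjoint finite_Diff)
    then show "p ^ card (C \<union> T) = p ^ card C * p ^ card (T - C)" by (simp add: power_add)
    show "C \<union> T \<subseteq> {..<m}" using \<open>T \<subseteq> E\<close> C(1) E by blast
  qed
  have "(\<Sum>S\<in>?P. \<Sum>T\<in>?T. if C \<union> T \<subseteq> S then wt m p S else 0)
      = (\<Sum>T\<in>?T. p ^ card C * p ^ card (T - C))"
    unfolding sum.swap[of _ ?T] by (intro sum.cong refl) (simp only: sup CT)
  also have "\<dots> = p ^ card C * (\<Sum>T\<in>?T. p ^ card (T - C))"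
    by (simp add: sum_distrib_left)
  also have "\<dots> \<le> p ^ card C * (1 / 2)"
    using sum_avoiding_trails p_pos by (intro mult_left_mono) auto
  finally have bad: "(\<Sum>S\<in>?P. \<Sum>T\<in>?T. if C \<union> T \<subseteq> S then wt m p S else 0) \<le> p ^ card C / 2"
    by simp
  have iso: "(\<Sum>S\<in>?P. if isolates a b E C x S then wt m p S else 0)
     = (\<Sum>S\<in>{S\<in>?P. isolates a b E C x S}. wt m p S)"
    by (intro sum.mono_neutral_cong_right) auto
  have "C \<subseteq> {..<m}" using C(1) E by blast
  with pw sup[of C] bad iso
  have *: "p ^ card C / 2 \<le> (\<Sum>S\<in>{S\<in>?P. isolates a b E C x S}. wt m p S)"
    by (simp add: sum.distrib)
  \<comment> \<open>With at most \<open>3 * g / 2\<close> edges in \<open>C\<close>, the exponent of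
    \<open>Q\<close> is at least \<open>- 62 * 3 / 2 = - 93\<close>.\<close>
  have "real (2 * card C) \<le> real (3 * g)" using C(4) by (simp only: of_nat_le_iff)
  then have "- 93 \<le> - 62 * real (card C) / g"
    using g by (simp add: field_simps)
  then have "Q powr (- 93) \<le> p ^ card C"
    unfolding p_power using Q_gt_1 by (intro powr_mono) auto
  moreover have "Q powr (- 93) = 1 / Q ^ 93"
    using Q_gt_1 by (simp add: powr_minus_divide)
  ultimately have "1 / Q ^ 93 / 2 \<le> p ^ card C / 2" by simp
  with * show ?thesis by simp
qed

end

section \<open>Isolating families\<close>

text \<open>A graph on the vertices \<open>{..<2 * m}\<close> is coded by the base-\<open>2 * m\<close> expansions \<open>u\<close>, \<open>w\<close> of its two lists
  of end vertices, and the \<open>j\<close>-th set of a family \<open>F\<close> occupies the bits \<open>m * j, \<dots>, m * j + m - 1\<close> of \<open>F\<close>.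
  With loops written as edges whose two ends coincide, every pair \<open>(u, w)\<close> is a valid graph.\<close>

definition digit :: "nat \<Rightarrow> nat \<Rightarrow> nat \<Rightarrow> nat" where
  "digit M w e = w div M ^ e mod M"

definition even_code :: "nat \<Rightarrow> nat \<Rightarrow> nat \<Rightarrow> nat \<Rightarrow> bool" where
  "even_code m u w T \<longleftrightarrow> (\<forall>v<2 * m. even (\<Sum>e<m. of_bool (e \<in> set_decode T) *
     (of_bool (digit (2 * m) u e = v) + of_bool (digit (2 * m) w e = v) :: nat)))"

definition code_card :: "nat \<Rightarrow> nat \<Rightarrow> nat" where
  "code_card m T = (\<Sum>e<m. of_bool (e \<in> set_decode T))"

text \<open>Sets and graphs are replaced by numbers and all quantifiers are bounded, so that
  decidability follows from the closure rules. The exponent 100 comes from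
  \<open>isolating_test_count_less\<close>.\<close>

definition isolating_family :: "nat \<Rightarrow> nat \<Rightarrow> nat \<Rightarrow> bool" where
  "isolating_family m g F \<longleftrightarrow>
     (\<forall>u<(2 * m) ^ m. \<forall>w<(2 * m) ^ m. \<forall>E<2 ^ m. \<forall>C<2 ^ m. \<forall>x<m.
        (\<forall>e<m. e \<in> set_decode C \<longrightarrow> e \<in> set_decode E) \<and> even_code m u w C \<and> x \<in> set_decode C \<and>
        2 * code_card m C \<le> 3 * g \<and>
        (\<forall>T<2 ^ m. (\<forall>e<m. e \<in> set_decode T \<longrightarrow> e \<in> set_decode E) \<and> even_code m u w T \<and> T \<noteq> 0 \<longrightarrow>
           g \<le> code_card m T) \<longrightarrow>
        (\<exists>j<(2 * m + 1) ^ 100. (\<forall>e<m. e \<in> set_decode C \<longrightarrow> m * j + e \<in> set_decode F) \<and>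
           (\<forall>T<2 ^ m. (\<forall>e<m. e \<in> set_decode T \<longrightarrow> e \<in> set_decode E \<and> m * j + e \<in> set_decode F) \<and>
              even_code m u w T \<and> T \<noteq> 0 \<longrightarrow> x \<in> set_decode T)))"

section \<open>Decidability of the isolating property\<close>

lemma computable_digit [computable_intros]:
  "computable f \<Longrightarrow> computable g \<Longrightarrow> computable h \<Longrightarrow> computable (\<lambda>x. digit (f x) (g x) (h x))"
  unfolding digit_def by (intro computable_intros)

lemma decidable_even_code [computable_intros]:
  assumes "computable f1" "computable f2" "computable f3" "computable f4"
  shows "decidable (\<lambda>x. even_code (f1 x) (f2 x) (f3 x) (f4 x))"
proof -
  have *: "decidable (\<lambda>z. even_code (fst (prod_decode z)) (fst (prod_decode (snd (prod_decode z))))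
      (fst (prod_decode (snd (prod_decode (snd (prod_decode z))))))
      (snd (prod_decode (snd (prod_decode (snd (prod_decode z)))))))"
    unfolding even_code_def by (intro computable_intros)
  have "computable (\<lambda>x. prod_encode (f1 x, prod_encode (f2 x, prod_encode (f3 x, f4 x))))"
    by (intro computable_intros assms)
  from decidable_comp[OF * this] show ?thesis by simp
qed

lemma computable_code_card [computable_intros]:
  assumes "computable f1" "computable f2"
  shows "computable (\<lambda>x. code_card (f1 x) (f2 x))"
proof -
  have *: "computable (\<lambda>z. code_card (fst (prod_decode z)) (snd (prod_decode z)))"
    unfolding code_card_def by (intro computable_intros)
  from computable_comp[OF * computable_pair[OF assms]] show ?thesis by simp
qed

lemma decidable_isolating_family [computable_intros]:
  assumes "computable f1" "computable f2" "computable f3"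
  shows "decidable (\<lambda>x. isolating_family (f1 x) (f2 x) (f3 x))"
proof -
  have *: "decidable (\<lambda>z. isolating_family (fst (prod_decode z)) (fst (prod_decode (snd (prod_decode z))))
      (snd (prod_decode (snd (prod_decode z)))))"
    unfolding isolating_family_def by (intro computable_intros)
  have "computable (\<lambda>x. prod_encode (f1 x, prod_encode (f2 x, f3 x)))"
    by (intro computable_intros assms)
  from decidable_comp[OF * this] show ?thesis by simp
qed

section \<open>Codes of edge sets\<close>

lemma set_decode_subset: "T < 2 ^ m \<Longrightarrow> set_decode T \<subseteq> {..<m}"
proof (rule subsetI, rule ccontr)
  fix n assume T: "T < 2 ^ m" "n \<in> set_decode T" "n \<notin> {..<m}"
  have "(2::nat) ^ m \<le> 2 ^ n" using T(3) by (intro power_increasing) auto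
  with T(1) have "T div 2 ^ n = 0" by (metis div_less less_le_trans)
  with T(2) show False by (simp add: set_decode_def)
qed

lemma set_encode_less: "A \<subseteq> {..<m} \<Longrightarrow> set_encode A < 2 ^ m"
proof -
  assume "A \<subseteq> {..<m}"
  then have "set_encode A \<le> (\<Sum>i<m. 2 ^ i)"
    unfolding set_encode_def by (intro sum_mono2) auto
  also have "\<dots> < 2 ^ m" by (induction m) auto
  finally show ?thesis .
qed

lemma all_set_codes: "(\<forall>T<2 ^ m. P (set_decode T)) \<longleftrightarrow> (\<forall>T\<subseteq>{..<m}. P T)"
  by (metis set_decode_subset set_encode_less set_encode_inverse finite_lessThan finite_subset)

lemma code_card_eq: "T < 2 ^ m \<Longrightarrow> code_card m T = card (set_decode T)"
proof -
  assume "T < 2 ^ m"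
  then have "{..<m} \<inter> {e. e \<in> set_decode T} = set_decode T" using set_decode_subset[of T m] by auto
  then show ?thesis by (simp add: code_card_def of_bool_def sum.If_cases)
qed

lemma even_code_iff:
  assumes "T < 2 ^ m"
  shows "even_code m u w T \<longleftrightarrow> even_set (digit (2 * m) u) (digit (2 * m) w) (set_decode T)"
proof -
  have sub: "set_decode T \<subseteq> {..<m}" using assms by (rule set_decode_subset)
  have "(\<Sum>e<m. of_bool (e \<in> set_decode T) *
     (of_bool (digit (2 * m) u e = v) + of_bool (digit (2 * m) w e = v) :: nat))
     = deg (digit (2 * m) u) (digit (2 * m) w) (set_decode T) v" for v
    unfolding deg_def using sub by (intro sum.mono_neutral_cong_right) auto
  moreover have "deg (digit (2 * m) u) (digit (2 * m) w) (set_decode T) v = 0" if "\<not> v < 2 * m" for v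
    unfolding deg_def
  proof (intro sum.neutral ballI)
    fix e assume "e \<in> set_decode T"
    then have "0 < m" using sub by auto
    then have "digit (2 * m) u e < 2 * m" "digit (2 * m) w e < 2 * m" by (simp_all add: digit_def)
    with that show "of_bool (digit (2 * m) u e = v) + of_bool (digit (2 * m) w e = v) = (0::nat)" by auto
  qed
  ultimately show ?thesis
    unfolding even_code_def even_set_def by (metis even_zero finite_set_decode)
qed

definition family_set :: "nat \<Rightarrow> nat \<Rightarrow> nat \<Rightarrow> nat set" where
  "family_set m F j = {e. e < m \<and> m * j + e \<in> set_decode F}"

lemma set_decode_eq_empty_iff: "set_decode T = {} \<longleftrightarrow> T = 0"
  by (metis set_decode_inverse set_decode_zero)

lemma isolating_family_iff:
  "isolating_family m g F \<longleftrightarrow>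
     (\<forall>u<(2 * m) ^ m. \<forall>w<(2 * m) ^ m. \<forall>E\<subseteq>{..<m}. \<forall>C\<subseteq>{..<m}. \<forall>x<m.
        C \<subseteq> E \<and> even_set (digit (2 * m) u) (digit (2 * m) w) C \<and> x \<in> C \<and> 2 * card C \<le> 3 * g \<and>
        girth_ge (digit (2 * m) u) (digit (2 * m) w) E g \<longrightarrow>
        (\<exists>j<(2 * m + 1) ^ 100.
           isolates (digit (2 * m) u) (digit (2 * m) w) E C x (family_set m F j)))"
proof -
  have sub: "(\<forall>e<m. e \<in> set_decode T \<longrightarrow> P e) \<longleftrightarrow> set_decode T \<subseteq> {e. P e}" if "T < 2 ^ m" for T P
    using set_decode_subset[OF that] by auto
  have girth: "(\<forall>T<2 ^ m. (\<forall>e<m. e \<in> set_decode T \<longrightarrow> e \<in> set_decode E) \<and> even_code m u w T \<and> T \<noteq> 0 \<longrightarrow>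
           g \<le> code_card m T) \<longleftrightarrow> girth_ge (digit (2 * m) u) (digit (2 * m) w) (set_decode E) g"
    if "E < 2 ^ m" for E u w
  proof -
    let ?P = "\<lambda>T. T \<subseteq> set_decode E \<and> even_set (digit (2 * m) u) (digit (2 * m) w) T \<and> T \<noteq> {} \<longrightarrow> g \<le> card T"
    have "(\<forall>T<2 ^ m. (\<forall>e<m. e \<in> set_decode T \<longrightarrow> e \<in> set_decode E) \<and> even_code m u w T \<and> T \<noteq> 0 \<longrightarrow>
           g \<le> code_card m T) \<longleftrightarrow> (\<forall>T<2 ^ m. ?P (set_decode T))"
      by (simp add: sub even_code_iff code_card_eq set_decode_eq_empty_iff cong: imp_cong)
    also have "\<dots> \<longleftrightarrow> (\<forall>T\<subseteq>{..<m}. ?P T)" by (rule all_set_codes)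
    also have "\<dots> \<longleftrightarrow> girth_ge (digit (2 * m) u) (digit (2 * m) w) (set_decode E) g"
      using set_decode_subset[OF that] unfolding girth_ge_def by blast
    finally show ?thesis .
  qed
  have iso: "(\<forall>e<m. e \<in> set_decode C \<longrightarrow> m * j + e \<in> set_decode F) \<and>
           (\<forall>T<2 ^ m. (\<forall>e<m. e \<in> set_decode T \<longrightarrow> e \<in> set_decode E \<and> m * j + e \<in> set_decode F) \<and>
              even_code m u w T \<and> T \<noteq> 0 \<longrightarrow> x \<in> set_decode T)
     \<longleftrightarrow> isolates (digit (2 * m) u) (digit (2 * m) w) (set_decode E) (set_decode C) x (family_set m F j)"
    if "E < 2 ^ m" "C < 2 ^ m" for E C u w x j
  proof -
    let ?P = "\<lambda>T. T \<subseteq> set_decode E \<inter> family_set m F j \<and> even_set (digit (2 * m) u) (digit (2 * m) w) T \<and> T \<noteq> {} \<longrightarrow> x \<in> T"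
    have 1: "(\<forall>e<m. e \<in> set_decode T \<longrightarrow> e \<in> set_decode E \<and> m * j + e \<in> set_decode F)
       \<longleftrightarrow> set_decode T \<subseteq> set_decode E \<inter> family_set m F j" if "T < 2 ^ m" for T
      using set_decode_subset[OF that] by (auto simp: family_set_def)
    have "(\<forall>T<2 ^ m. (\<forall>e<m. e \<in> set_decode T \<longrightarrow> e \<in> set_decode E \<and> m * j + e \<in> set_decode F) \<and>
              even_code m u w T \<and> T \<noteq> 0 \<longrightarrow> x \<in> set_decode T) \<longleftrightarrow> (\<forall>T<2 ^ m. ?P (set_decode T))"
      by (simp add: 1 even_code_iff set_decode_eq_empty_iff cong: imp_cong)
    also have "\<dots> \<longleftrightarrow> (\<forall>T\<subseteq>{..<m}. ?P T)" by (rule all_set_codes)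
    also have "\<dots> \<longleftrightarrow> (\<forall>T\<subseteq>set_decode E \<inter> family_set m F j. even_set (digit (2 * m) u) (digit (2 * m) w) T \<and> T \<noteq> {} \<longrightarrow> x \<in> T)"
      using set_decode_subset[OF that(1)] by blast
    finally show ?thesis
      using set_decode_subset[OF that(2)] unfolding isolates_def family_set_def by auto
  qed
  \<comment> \<open>Naming the matrix exhibits it as a function of the decoded sets, the form in
    which \<open>all_set_codes\<close> replaces codes by sets.\<close>
  define \<Phi> where "\<Phi> = (\<lambda>u w E C x. C \<subseteq> E \<and> even_set (digit (2 * m) u) (digit (2 * m) w) C \<and> x \<in> C \<and>
     2 * card C \<le> 3 * g \<and> girth_ge (digit (2 * m) u) (digit (2 * m) w) E g \<longrightarrow>
     (\<exists>j<(2 * m + 1) ^ 100.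
        isolates (digit (2 * m) u) (digit (2 * m) w) E C x (family_set m F j)))"
  have body: "((\<forall>e<m. e \<in> set_decode C \<longrightarrow> e \<in> set_decode E) \<and> even_code m u w C \<and> x \<in> set_decode C \<and>
        2 * code_card m C \<le> 3 * g \<and>
        (\<forall>T<2 ^ m. (\<forall>e<m. e \<in> set_decode T \<longrightarrow> e \<in> set_decode E) \<and> even_code m u w T \<and> T \<noteq> 0 \<longrightarrow>
           g \<le> code_card m T) \<longrightarrow>
        (\<exists>j<(2 * m + 1) ^ 100. (\<forall>e<m. e \<in> set_decode C \<longrightarrow> m * j + e \<in> set_decode F) \<and>
           (\<forall>T<2 ^ m. (\<forall>e<m. e \<in> set_decode T \<longrightarrow> e \<in> set_decode E \<and> m * j + e \<in> set_decode F) \<and>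
              even_code m u w T \<and> T \<noteq> 0 \<longrightarrow> x \<in> set_decode T)))
      \<longleftrightarrow> \<Phi> u w (set_decode E) (set_decode C) x" if "E < 2 ^ m" "C < 2 ^ m" for u w E C x
    unfolding iso[OF that] girth[OF that(1)]
    unfolding sub[OF that(2)] even_code_iff[OF that(2)]
      code_card_eq[OF that(2)] \<Phi>_def Collect_mem_eq ..
  have C: "(\<forall>C<2 ^ m. \<forall>x<m. \<Phi> u w E (set_decode C) x) \<longleftrightarrow> (\<forall>C\<subseteq>{..<m}. \<forall>x<m. \<Phi> u w E C x)" for u w E
    by (rule all_set_codes)
  have E: "(\<forall>E<2 ^ m. \<forall>C\<subseteq>{..<m}. \<forall>x<m. \<Phi> u w (set_decode E) C x)
      \<longleftrightarrow> (\<forall>E\<subseteq>{..<m}. \<forall>C\<subseteq>{..<m}. \<forall>x<m. \<Phi> u w E C x)" for u w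
    by (rule all_set_codes)
  have "isolating_family m g F \<longleftrightarrow> (\<forall>u<(2 * m) ^ m. \<forall>w<(2 * m) ^ m. \<forall>E<2 ^ m. \<forall>C<2 ^ m. \<forall>x<m.
      \<Phi> u w (set_decode E) (set_decode C) x)"
    unfolding isolating_family_def by (simp only: body cong: imp_cong)
  then show ?thesis
    unfolding C E unfolding \<Phi>_def .
qed

section \<open>Existence of isolating families\<close>

lemma ex_digits:
  "(\<And>e. e < n \<Longrightarrow> f e < M) \<Longrightarrow> \<exists>w<M ^ n. \<forall>e<n. digit M w e = f e"
proof (induction n)
  case (Suc n)
  then obtain w where w: "w < M ^ n" "\<And>e. e < n \<Longrightarrow> digit M w e = f e" by auto
  have fM: "f n < M" using Suc.prems by simp
  have "digit M (w + f n * M ^ n) e = f e" if "e < Suc n" for e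
  proof (cases "e = n")
    case True
    then show ?thesis using w(1) fM by (simp add: digit_def)
  next
    case False
    then have "e < n" using that by simp
    \<comment> \<open>Below position \<open>n\<close>, the new leading term is a multiple of
      \<open>M ^ Suc e\<close>, so after division by \<open>M ^ e\<close> it vanishes modulo
      \<open>M\<close>.\<close>
    then have "M ^ n = M ^ e * (M * M ^ (n - e - 1))"
      by (metis (no_types) power_add power_Suc le_add_diff_inverse less_imp_le_nat
          Suc_diff_Suc diff_Suc_eq_diff_pred diff_diff_left Suc_eq_plus1)
    then have "w + f n * M ^ n = w + (f n * M ^ (n - e - 1) * M) * M ^ e" by simp
    then have "(w + f n * M ^ n) div M ^ e = w div M ^ e + f n * M ^ (n - e - 1) * M"
      using fM by (metis add.commute div_mult_self1 not_less0 power_not_zero)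
    then show ?thesis using w(2)[OF \<open>e < n\<close>] by (simp add: digit_def)
  qed
  moreover have "w + f n * M ^ n < M ^ Suc n"
  proof -
    have "w + f n * M ^ n < Suc (f n) * M ^ n" using w(1) by simp
    also have "\<dots> \<le> M * M ^ n" using fM by (intro mult_right_mono) auto
    finally show ?thesis by simp
  qed
  ultimately show ?case by blast
qed simp

text \<open>Since \<open>93 + 7 = 100\<close>, the missed fraction is at most
  \<open>exp (- (Q ^ 7 / 2))\<close>. The second factor counts graphs, edge sets \<open>E\<close>
  and \<open>C\<close>, and edges \<open>x\<close>. It is at most
  \<open>exp (2 * m * Q + 3 * m)\<close>, hence at most \<open>exp (2 * Q ^ 2)\<close>, and
  \<open>2 * Q ^ 2 < Q ^ 7 / 2\<close> for \<open>Q \<ge> 3\<close>.\<close>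

lemma isolating_test_count_less:
  fixes m :: nat
  assumes "0 < m"
  defines "Q \<equiv> real (2 * m + 1)"
  shows "(1 - 1 / (2 * Q ^ 93)) ^ ((2 * m + 1) ^ 100)
           * real ((2 * m) ^ m * ((2 * m) ^ m * (2 ^ m * (2 ^ m * m)))) < 1"
proof -
  have Q: "3 \<le> Q" using assms by (simp add: Q_def)
  have "1 - 1 / (2 * Q ^ 93) \<le> exp (- (1 / (2 * Q ^ 93)))"
    using exp_ge_add_one_self[of "- (1 / (2 * Q ^ 93))"] by simp
  moreover have "0 \<le> 1 - 1 / (2 * Q ^ 93)"
  proof -
    have "1 \<le> Q ^ 93" using Q by (intro one_le_power) simp
    then have "1 / (2 * Q ^ 93) \<le> 1" by (subst divide_le_eq_1_pos) linarith+
    then show ?thesis by simp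
  qed
  ultimately have "(1 - 1 / (2 * Q ^ 93)) ^ ((2 * m + 1) ^ 100)
      \<le> exp (- (1 / (2 * Q ^ 93))) ^ ((2 * m + 1) ^ 100)"
    by (rule power_mono)
  also have "\<dots> = exp (real ((2 * m + 1) ^ 100) * - (1 / (2 * Q ^ 93)))"
    by (simp only: exp_of_nat_mult)
  also have "real ((2 * m + 1) ^ 100) = Q ^ 93 * Q ^ 7"
    unfolding Q_def of_nat_power power_add[symmetric] by simp
  also have "Q ^ 93 * Q ^ 7 * - (1 / (2 * Q ^ 93)) = - (Q ^ 7 / 2)"
  proof -
    have "c * d * - (1 / (2 * c)) = - (d / 2)" if "c \<noteq> 0" for c d :: real
      using that by simp
    moreover have "Q ^ 93 \<noteq> 0" using Q by simp
    ultimately show ?thesis .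
  qed
  finally have 1: "(1 - 1 / (2 * Q ^ 93)) ^ ((2 * m + 1) ^ 100) \<le> exp (- (Q ^ 7 / 2))" .
  have m: "real m \<le> exp (real m)" "2 * real m \<le> exp Q"
    using exp_ge_add_one_self[of "real m"] exp_ge_add_one_self[of Q] unfolding Q_def by linarith+
  have "real ((2 * m) ^ m) \<le> exp (real m * Q)"
    using power_mono[OF m(2), of m]
    unfolding of_nat_power of_nat_mult of_nat_numeral exp_of_nat_mult by simp
  moreover have "(2::real) ^ m \<le> exp (real m)"
    using exp_ge_add_one_self[of 1] power_mono[of 2 "exp (1::real)" m]
    by (simp add: exp_of_nat_mult[symmetric])
  ultimately have "real ((2 * m) ^ m * ((2 * m) ^ m * (2 ^ m * (2 ^ m * m))))
      \<le> exp (real m * Q) * (exp (real m * Q) * (exp (real m) * (exp (real m) * exp (real m))))"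
    using m(1) unfolding of_nat_mult of_nat_power of_nat_numeral
    by (intro mult_mono) (auto intro!: mult_nonneg_nonneg)
  also have "\<dots> = exp (2 * real m * Q + 3 * real m)" by (simp add: exp_add[symmetric] algebra_simps)
  finally have "real ((2 * m) ^ m * ((2 * m) ^ m * (2 ^ m * (2 ^ m * m)))) \<le> exp (2 * real m * Q + 3 * real m)" .
  with 1 have "(1 - 1 / (2 * Q ^ 93)) ^ ((2 * m + 1) ^ 100)
           * real ((2 * m) ^ m * ((2 * m) ^ m * (2 ^ m * (2 ^ m * m))))
     \<le> exp (- (Q ^ 7 / 2)) * exp (2 * real m * Q + 3 * real m)"
    by (intro mult_mono) auto
  also have "\<dots> = exp (2 * real m * Q + 3 * real m - Q ^ 7 / 2)" by (simp add: exp_add[symmetric])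
  also have "\<dots> < 1"
  proof -
    have "2 * real m * Q + 3 * real m \<le> Q * Q + Q * Q"
    proof (rule add_mono)
      show "2 * real m * Q \<le> Q * Q" using Q by (intro mult_right_mono) (auto simp: Q_def)
      have "3 * real m \<le> 3 * Q" by (simp add: Q_def)
      also have "\<dots> \<le> Q * Q" using Q by (intro mult_right_mono) auto
      finally show "3 * real m \<le> Q * Q" .
    qed
    also have "\<dots> = 2 * Q ^ 2" by (simp add: power2_eq_square)
    also have "\<dots> < 3 ^ 5 / 2 * Q ^ 2" using Q by simp
    also have "\<dots> \<le> Q ^ 5 / 2 * Q ^ 2"
      using Q by (intro mult_right_mono divide_right_mono power_mono) auto
    also have "\<dots> = Q ^ 7 / 2" by (simp add: power_add[symmetric])
    finally show ?thesis by simp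
  qed
  finally show ?thesis .
qed

text \<open>Greedy covering is applied to all tests: a graph, a set \<open>E\<close> of girth at
  least \<open>g\<close>, a short even set \<open>C\<close> in it and an edge \<open>x\<close> of
  \<open>C\<close>. Fewer than one test remains missed, hence none.\<close>

lemma isolating_family_exists:
  assumes "0 < g"
  shows "\<exists>F. isolating_family m g F"
proof -
  define Q where "Q = real (2 * m + 1)"
  define p where "p = Q powr (- 62 / g)"
  define N where "N = (2 * m + 1) ^ 100"
  let ?d = "digit (2 * m)"
  define X where "X = {(u, w, E, C, x). u < (2 * m) ^ m \<and> w < (2 * m) ^ m \<and> E \<subseteq> {..<m} \<and> C \<subseteq> {..<m} \<and> x < m \<and>
     C \<subseteq> E \<and> even_set (?d u) (?d w) C \<and> x \<in> C \<and> 2 * card C \<le> 3 * g \<and> girth_ge (?d u) (?d w) E g}"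
  define R where "R = (\<lambda>S (u, w, E, C, x). isolates (?d u) (?d w) E C x S)"
  have Q1: "1 \<le> Q" by (simp add: Q_def)
  have p: "0 \<le> p" "p \<le> 1"
    using powr_mono[of "- 62 / g" 0 Q] Q1 by (auto simp: p_def)
  have sub: "X \<subseteq> {..<(2 * m) ^ m} \<times> {..<(2 * m) ^ m} \<times> Pow {..<m} \<times> Pow {..<m} \<times> {..<m}" (is "_ \<subseteq> ?Y")
    unfolding X_def by auto
  have finY: "finite ?Y" by simp
  have finX: "finite X" using finite_subset[OF sub finY] .
  have "card X \<le> card ?Y" using card_mono[OF finY sub] .
  also have "\<dots> = (2 * m) ^ m * ((2 * m) ^ m * (2 ^ m * (2 ^ m * m)))"
    by (simp only: card_cartesian_product card_lessThan card_Pow finite_lessThan)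
  finally have cX: "card X \<le> (2 * m) ^ m * ((2 * m) ^ m * (2 ^ m * (2 ^ m * m)))" .
  have "\<exists>F. (\<forall>j. F j \<in> Pow {..<m}) \<and>
     real (card {x\<in>X. \<forall>j<N. \<not> R (F j) x}) \<le> (1 - 1 / (2 * Q ^ 93)) ^ N * card X"
  proof (rule greedy_cover)
    show "0 \<le> wt m p S" for S using p by (simp add: wt_def)
    show "sum (wt m p) (Pow {..<m}) = 1"
      using sum_wt_supersets[of "{}" m p] by (simp add: Pow_def)
    have "1 \<le> Q ^ 93" using Q1 by (rule one_le_power)
    then show "1 / (2 * Q ^ 93) \<le> 1" by (subst divide_le_eq_1_pos) linarith+
  next
    fix z assume z: "z \<in> X"
    obtain u w E C x where zz: "z = (u, w, E, C, x)" by (cases z)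
    from z have h: "E \<subseteq> {..<m}" "C \<subseteq> E" "even_set (?d u) (?d w) C" "x \<in> C" "2 * card C \<le> 3 * g"
      "girth_ge (?d u) (?d w) E g" by (auto simp: X_def zz)
    have "?d u e < 2 * m \<and> ?d w e < 2 * m" if "e \<in> E" for e
      using that h(1) by (auto simp: digit_def)
    from isolating_weight[OF h(1) this h(6) assms h(2-5)]
    show "1 / (2 * Q ^ 93) \<le> (\<Sum>S\<in>{S\<in>Pow {..<m}. R S z}. wt m p S)"
      by (simp add: R_def zz Q_def p_def)
  qed (use finX in auto)
  then obtain F where F: "\<And>j. F j \<subseteq> {..<m}"
    "real (card {x\<in>X. \<forall>j<N. \<not> R (F j) x}) \<le> (1 - 1 / (2 * Q ^ 93)) ^ N * card X" by blast
  have hit: "\<exists>j<N. R (F j) z" if "z \<in> X" for z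
  proof (rule ccontr)
    assume "\<not> (\<exists>j<N. R (F j) z)"
    with that have "z \<in> {x\<in>X. \<forall>j<N. \<not> R (F j) x}" by auto
    then have "0 < card {x\<in>X. \<forall>j<N. \<not> R (F j) x}" 
      using finX by (intro card_gt_0_iff[THEN iffD2] conjI) (blast, simp)
    then have "1 \<le> real (card {x\<in>X. \<forall>j<N. \<not> R (F j) x})" by simp
    also have "\<dots> \<le> (1 - 1 / (2 * Q ^ 93)) ^ N * card X" by (rule F(2))
    also have "\<dots> \<le> (1 - 1 / (2 * Q ^ 93)) ^ N * real ((2 * m) ^ m * ((2 * m) ^ m * (2 ^ m * (2 ^ m * m))))"
    proof (rule mult_left_mono)
      have "1 \<le> Q ^ 93" using Q1 by (rule one_le_power)
      then have "1 / (2 * Q ^ 93) \<le> 1" by (subst divide_le_eq_1_pos) linarith+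
      then show "0 \<le> (1 - 1 / (2 * Q ^ 93)) ^ N" by (intro zero_le_power) simp
    qed (use cX in \<open>simp only: of_nat_le_iff\<close>)
    \<comment> \<open>A test contains an edge \<open>x < m\<close>, so \<open>0 < m\<close>, as the
      counting bound requires.\<close>
    also have "\<dots> < 1"
      using isolating_test_count_less[of m] that unfolding N_def Q_def by (auto simp: X_def)
    finally show False by simp
  qed
  define A where "A = (\<lambda>(j, e). m * j + e) ` {(j, e). j < N \<and> e < m \<and> e \<in> F j}"
  have "finite {(j, e). j < N \<and> e < m \<and> e \<in> F j}"
    by (rule finite_subset[of _ "{..<N} \<times> {..<m}"]) auto
  then have "finite A" by (simp add: A_def)
  have fam: "family_set m (set_encode A) j = F j" if "j < N" for j
  proof -
    have "m * j + e \<in> A \<longleftrightarrow> e \<in> F j" if "e < m" for e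
    proof
      assume "m * j + e \<in> A"
      then obtain j' e' where eq: "m * j + e = m * j' + e'" and "e' < m" "e' \<in> F j'"
        by (auto simp: A_def)
      moreover from \<open>e' < m\<close> \<open>e < m\<close> have "j = j'" "e = e'"
        using arg_cong[OF eq, of "\<lambda>x. x div m"] arg_cong[OF eq, of "\<lambda>x. x mod m"] by simp_all
      ultimately show "e \<in> F j" by simp
    qed (use that \<open>j < N\<close> in \<open>force simp: A_def\<close>)
    then show ?thesis
      using F(1)[of j] \<open>finite A\<close> by (auto simp: family_set_def set_encode_inverse)
  qed
  have "isolating_family m g (set_encode A)"
    unfolding isolating_family_iff N_def[symmetric]
  proof (intro allI impI, elim conjE)
    fix u w E C x
    assume "u < (2 * m) ^ m" "w < (2 * m) ^ m" "E \<subseteq> {..<m}" "C \<subseteq> {..<m}" "x < m" "C \<subseteq> E"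
      "even_set (?d u) (?d w) C" "x \<in> C" "2 * card C \<le> 3 * g" "girth_ge (?d u) (?d w) E g"
    then have "(u, w, E, C, x) \<in> X" by (simp add: X_def)
    from hit[OF this] obtain j where "j < N" "isolates (?d u) (?d w) E C x (F j)"
      by (auto simp: R_def)
    then show "\<exists>j<N. isolates (?d u) (?d w) E C x (family_set m (set_encode A) j)"
      using fam by auto
  qed
  then show ?thesis by blast
qed

text \<open>At most \<open>2 * m\<close> vertices are ends of edges, so these can be renumbered
  below \<open>2 * m\<close> without changing which edge sets are even.\<close>

lemma graphic_matroid_digits:
  assumes "graphic_matroid {..<m} Ind"
  obtains u w where "u < (2 * m) ^ m" "w < (2 * m) ^ m"
    "\<And>S. Ind S \<longleftrightarrow> S \<subseteq> {..<m} \<and>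
       \<not> (\<exists>T\<subseteq>S. T \<noteq> {} \<and> even_set (digit (2 * m) u) (digit (2 * m) w) T)"
proof -
  obtain G :: "(nat, nat) mgraph" where G: "wf_mgraph G" "edges G = {..<m}"
    "\<And>S. Ind S \<longleftrightarrow> S \<subseteq> {..<m} \<and> \<not> contains_cycle G S"
    using assms unfolding graphic_matroid_def by blast
  have "\<forall>e\<in>{..<m}. \<exists>ab. ends G e = {fst ab, snd ab}"
  proof
    fix e assume "e \<in> {..<m}"
    then have "card (ends G e) \<in> {1, 2}" using G(1,2) by (auto simp: wf_mgraph_def)
    then show "\<exists>ab. ends G e = {fst ab, snd ab}"
      by (auto simp: card_1_singleton_iff card_2_iff intro: exI[of _ "(_, _)"]) 
  qed
  then obtain ab where ab: "\<And>e. e \<in> edges G \<Longrightarrow> ends G e = {fst (ab e), snd (ab e)}"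
    using G(2) by metis
  define a where "a = fst \<circ> ab"
  define b where "b = snd \<circ> ab"
  have ends: "\<And>e. e \<in> edges G \<Longrightarrow> ends G e = {a e, b e}" using ab by (simp add: a_def b_def)
  define V where "V = a ` {..<m} \<union> b ` {..<m}"
  have "finite V" by (simp add: V_def)
  have "card V \<le> card (a ` {..<m}) + card (b ` {..<m})" unfolding V_def by (rule card_Un_le)
  also have "\<dots> \<le> m + m"
    using card_image_le[of "{..<m}" a] card_image_le[of "{..<m}" b] by simp
  finally have "card V \<le> 2 * m" by simp
  obtain \<phi> where \<phi>: "bij_betw \<phi> V {0..<card V}"
    using ex_bij_betw_finite_nat[OF \<open>finite V\<close>] by blast
  then have inj: "inj_on \<phi> V" by (simp add: bij_betw_def)
  have less: "\<phi> v < 2 * m" if "v \<in> V" for v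
    using bij_betwE[OF \<phi>] that \<open>card V \<le> 2 * m\<close> by fastforce
  obtain u where u: "u < (2 * m) ^ m" "\<And>e. e < m \<Longrightarrow> digit (2 * m) u e = (\<phi> \<circ> a) e"
    using ex_digits[of m "\<phi> \<circ> a" "2 * m"] less by (auto simp: V_def)
  obtain w where w: "w < (2 * m) ^ m" "\<And>e. e < m \<Longrightarrow> digit (2 * m) w e = (\<phi> \<circ> b) e"
    using ex_digits[of m "\<phi> \<circ> b" "2 * m"] less by (auto simp: V_def)
  have ev: "even_set (digit (2 * m) u) (digit (2 * m) w) T \<longleftrightarrow> even_set a b T" if "T \<subseteq> {..<m}" for T
  proof -
    have "even_set (digit (2 * m) u) (digit (2 * m) w) T \<longleftrightarrow> even_set (\<phi> \<circ> a) (\<phi> \<circ> b) T"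
      using that u w by (intro even_set_cong) auto
    also have "\<dots> \<longleftrightarrow> even_set a b T"
      using that inj by (intro even_set_inj[of _ V]) (auto simp: V_def)
    finally show ?thesis .
  qed
  show ?thesis
  proof (rule that[OF u(1) w(1)])
    fix S
    have "contains_cycle G S \<longleftrightarrow> (\<exists>T\<subseteq>S. T \<noteq> {} \<and> even_set (digit (2 * m) u) (digit (2 * m) w) T)"
      if "S \<subseteq> {..<m}"
      using contains_cycle_iff[OF G(1) ends, of S] G(2) that ev by (metis order_trans)
    then show "Ind S \<longleftrightarrow> S \<subseteq> {..<m} \<and>
       \<not> (\<exists>T\<subseteq>S. T \<noteq> {} \<and> even_set (digit (2 * m) u) (digit (2 * m) w) T)"
      using G(3) by blast
  qed
qed

section \<open>The algorithm\<close>

text \<open>Once all nonempty even sets of at most \<open>3 * r / 2\<close> edges are gone, the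
  girth is at least the next integer \<open>3 * r div 2 + 1\<close>.\<close>

definition girth_bound :: "nat \<Rightarrow> nat" where
  "girth_bound n = rec_nat 1 (\<lambda>_ r. 3 * r div 2 + 1) n"

text \<open>The least code is a canonical choice that unbounded search finds, so no advice depending
  on \<open>m\<close> enters. The search makes no oracle queries.\<close>

definition family :: "nat \<Rightarrow> nat \<Rightarrow> nat" where
  "family m i = (LEAST F. isolating_family m (girth_bound i) F)"

text \<open>The set of edges still alive is read off the answers alone; earlier queries need not be recomputed.\<close>

definition answered :: "nat \<Rightarrow> nat \<Rightarrow> nat \<Rightarrow> nat \<Rightarrow> nat \<Rightarrow> bool" where
  "answered m c i j k \<longleftrightarrow> list_code_nth (list_code_nth c i) (j * (m + 1) + k) = 1"

definition kept :: "nat \<Rightarrow> nat \<Rightarrow> nat \<Rightarrow> nat \<Rightarrow> bool" where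
  "kept m c n e \<longleftrightarrow>
     (\<forall>i<n. \<forall>j<(2 * m + 1) ^ 100. \<not> (answered m c i j e \<and> \<not> answered m c i j (Suc e)))"

text \<open>Under \<open>sum_decode\<close>, even codes are query batches and odd codes are outputs.
  Query \<open>q\<close> stands for the set with index \<open>q div (m + 1)\<close>, cut off at
  \<open>q mod (m + 1)\<close>, which ranges over the \<open>m + 1\<close> cuts from 0 to
  \<open>m\<close>. Stopping is right once the girth bound exceeds \<open>m\<close>, the number of
  all edges.\<close>

definition next_action :: "nat \<Rightarrow> nat \<Rightarrow> nat \<Rightarrow> nat" where
  "next_action m c n =
     (if m < girth_bound n then Suc (2 * set_encode {e. e < m \<and> kept m c n e})
      else 2 * list_encode (map (\<lambda>q. set_encode {e. e < m \<and> kept m c n e \<and> e < q mod (m + 1) \<and>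
                                   m * (q div (m + 1)) + e \<in> set_decode (family m n)})
             [0..<(2 * m + 1) ^ 100 * (m + 1)]))"

definition basis_step :: "nat \<Rightarrow> nat" where
  "basis_step x = next_action (fst (prod_decode x)) (snd (prod_decode x))
     (list_code_length (snd (prod_decode x)))"

section \<open>Computability of one step\<close>

lemma girth_bound_simps [simp]:
  "girth_bound 0 = 1" "girth_bound (Suc n) = 3 * girth_bound n div 2 + 1"
  by (simp_all add: girth_bound_def)

lemma girth_bound_pos: "0 < girth_bound n"
  by (cases n) auto

lemma isolating_family_family: "isolating_family m (girth_bound i) (family m i)"
  unfolding family_def using isolating_family_exists[OF girth_bound_pos] by (rule LeastI_ex)

lemma computable_girth_bound [computable_intros]:
  "computable f \<Longrightarrow> computable (\<lambda>x. girth_bound (f x))"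
  unfolding girth_bound_def by (intro computable_intros)

lemma computable_family [computable_intros]:
  assumes "computable f1" "computable f2"
  shows "computable (\<lambda>x. family (f1 x) (f2 x))"
proof -
  have *: "computable (\<lambda>z. family (fst (prod_decode z)) (snd (prod_decode z)))"
    unfolding family_def
    by (intro computable_intros isolating_family_exists girth_bound_pos)
  from computable_comp[OF * computable_pair[OF assms]] show ?thesis by simp
qed

lemma decidable_kept [computable_intros]:
  assumes "computable f1" "computable f2" "computable f3" "computable f4"
  shows "decidable (\<lambda>x. kept (f1 x) (f2 x) (f3 x) (f4 x))"
proof -
  have *: "decidable (\<lambda>z. kept (fst (prod_decode z)) (fst (prod_decode (snd (prod_decode z))))
      (fst (prod_decode (snd (prod_decode (snd (prod_decode z))))))
      (snd (prod_decode (snd (prod_decode (snd (prod_decode z)))))))"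
    unfolding kept_def answered_def by (intro computable_intros)
  have "computable (\<lambda>x. prod_encode (f1 x, prod_encode (f2 x, prod_encode (f3 x, f4 x))))"
    by (intro computable_intros assms)
  from decidable_comp[OF * this] show ?thesis by simp
qed

lemma computable_basis_step: "computable (\<lambda>x. basis_step x)"
  unfolding basis_step_def next_action_def by (intro computable_intros)

section \<open>The run in terms of sets, and its agreement with the coded step\<close>

definition prefix_query :: "nat set \<Rightarrow> nat \<Rightarrow> nat \<Rightarrow> nat \<Rightarrow> nat \<Rightarrow> nat set" where
  "prefix_query E m i j k = {e \<in> E. e < k \<and> e \<in> family_set m (family m i) j}"

primrec survivors :: "(nat set \<Rightarrow> bool) \<Rightarrow> nat \<Rightarrow> nat \<Rightarrow> nat set" where
  "survivors Ind m 0 = {..<m}"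
| "survivors Ind m (Suc i) = {e \<in> survivors Ind m i. \<forall>j<(2 * m + 1) ^ 100.
     \<not> (Ind (prefix_query (survivors Ind m i) m i j e) \<and>
        \<not> Ind (prefix_query (survivors Ind m i) m i j (Suc e)))}"

definition queries :: "(nat set \<Rightarrow> bool) \<Rightarrow> nat \<Rightarrow> nat \<Rightarrow> nat set list" where
  "queries Ind m i = map (\<lambda>q. prefix_query (survivors Ind m i) m i (q div (m + 1)) (q mod (m + 1)))
     [0..<(2 * m + 1) ^ 100 * (m + 1)]"

definition transcript :: "(nat set \<Rightarrow> bool) \<Rightarrow> nat \<Rightarrow> nat \<Rightarrow> bool list list" where
  "transcript Ind m n = map (\<lambda>i. map Ind (queries Ind m i)) [0..<n]"

definition transcript_code :: "(nat set \<Rightarrow> bool) \<Rightarrow> nat \<Rightarrow> nat \<Rightarrow> nat" where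
  "transcript_code Ind m n = list_encode (map (\<lambda>as. list_encode (map of_bool as)) (transcript Ind m n))"

lemma survivors_subset: "survivors Ind m i \<subseteq> {..<m}"
  by (induction i) auto

lemma answered_transcript_code:
  assumes "i < n" "j < (2 * m + 1) ^ 100" "k \<le> m"
  shows "answered m (transcript_code Ind m n) i j k \<longleftrightarrow> Ind (prefix_query (survivors Ind m i) m i j k)"
proof -
  have "j * (m + 1) + k < Suc j * (m + 1)" using assms(3) by simp
  also have "\<dots> \<le> (2 * m + 1) ^ 100 * (m + 1)" using assms(2) by (intro mult_right_mono) auto
  finally have less: "j * (m + 1) + k < (2 * m + 1) ^ 100 * (m + 1)" .
  have dm: "(j * (m + 1) + k) div (m + 1) = j" "(j * (m + 1) + k) mod (m + 1) = k"
    using assms(3) by (simp_all only: div_mult_self3 mod_mult_self3) auto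
  have "list_code_nth (transcript_code Ind m n) i = list_encode (map of_bool (map Ind (queries Ind m i)))"
    using assms(1) by (simp add: transcript_code_def transcript_def list_code_nth)
  moreover have "list_code_nth (list_encode (map of_bool (map Ind (queries Ind m i)))) (j * (m + 1) + k)
      = of_bool (Ind (prefix_query (survivors Ind m i) m i j k))"
    using less dm by (simp add: queries_def list_code_nth del: mult_Suc_right)
  ultimately show ?thesis by (simp only: answered_def) simp
qed

lemma kept_transcript_code:
  "n' \<le> n \<Longrightarrow> {e. e < m \<and> kept m (transcript_code Ind m n) n' e} = survivors Ind m n'"
proof (induction n')
  case 0
  then show ?case by (auto simp: kept_def)
next
  case (Suc n')
  let ?k = "kept m (transcript_code Ind m n)"
  have "{e. e < m \<and> ?k (Suc n') e} = {e \<in> {e. e < m \<and> ?k n' e}. \<forall>j<(2 * m + 1) ^ 100.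
      \<not> (answered m (transcript_code Ind m n) n' j e \<and> \<not> answered m (transcript_code Ind m n) n' j (Suc e))}"
    by (auto simp: kept_def less_Suc_eq)
  also have "\<dots> = survivors Ind m (Suc n')"
    using Suc answered_transcript_code[of n' n _ m _ Ind] survivors_subset[of Ind m n'] by auto
  finally show ?case .
qed

lemma decode_next_action:
  "decode_action (basis_step (encode_input m (transcript Ind m n))) =
     (if m < girth_bound n then Return (survivors Ind m n) else Query (queries Ind m n))"
proof -
  let ?c = "transcript_code Ind m n"
  have step: "basis_step (encode_input m (transcript Ind m n)) = next_action m ?c n"
    by (simp add: basis_step_def encode_input_def transcript_code_def[symmetric])
       (simp add: transcript_code_def list_code_length transcript_def)
  have kept: "e < m \<and> kept m ?c n e \<longleftrightarrow> e \<in> survivors Ind m n" for e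
    using kept_transcript_code[of n n m Ind] by blast
  show ?thesis
  proof (cases "m < girth_bound n")
    case True
    then have "next_action m ?c n = sum_encode (Inr (set_encode (survivors Ind m n)))"
      by (simp add: next_action_def kept sum_encode_def)
    moreover have "finite (survivors Ind m n)"
      by (rule finite_subset[OF survivors_subset finite_lessThan])
    ultimately show ?thesis
      using True by (simp add: step decode_action_def)
  next
    case False
    have "{e. e < m \<and> kept m ?c n e \<and> e < q mod (m + 1) \<and> m * (q div (m + 1)) + e \<in> set_decode (family m n)}
        = prefix_query (survivors Ind m n) m n (q div (m + 1)) (q mod (m + 1))" for q
      using kept by (auto simp: prefix_query_def family_set_def)
    then have "next_action m ?c n = sum_encode (Inl (list_encode (map set_encode (queries Ind m n))))"
      using False by (simp only: next_action_def queries_def sum_encode_def if_False map_map comp_def sum.case)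
    moreover have "map set_decode (map set_encode (queries Ind m n)) = queries Ind m n"
    proof (unfold map_map, rule map_idI)
      fix S assume "S \<in> set (queries Ind m n)"
      then have "S \<subseteq> {..<m}"
        using survivors_subset[of Ind m n] by (auto simp: queries_def prefix_query_def)
      then have "finite S" by (rule finite_subset) simp
      then show "(set_decode \<circ> set_encode) S = S" by simp
    qed
    ultimately show ?thesis
      using False by (simp add: step decode_action_def del: map_map)
  qed
qed

section \<open>Correctness of the output\<close>

lemma survivors_girth:
  assumes u: "u < (2 * m) ^ m" and w: "w < (2 * m) ^ m"
    and Ind: "\<And>S. Ind S \<longleftrightarrow> S \<subseteq> {..<m} \<and>
       \<not> (\<exists>T\<subseteq>S. T \<noteq> {} \<and> even_set (digit (2 * m) u) (digit (2 * m) w) T)"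
  shows "girth_ge (digit (2 * m) u) (digit (2 * m) w) (survivors Ind m i) (girth_bound i)"
proof (induction i)
  case 0
  show ?case
    unfolding girth_ge_def by (auto simp: even_set_def Suc_le_eq card_gt_0_iff)
next
  case (Suc i)
  let ?a = "digit (2 * m) u" and ?b = "digit (2 * m) w" and ?E = "survivors Ind m i"
  show ?case
    unfolding girth_ge_def
  proof (intro allI impI, rule ccontr)
    fix C assume C: "C \<subseteq> survivors Ind m (Suc i)" "even_set ?a ?b C \<and> C \<noteq> {}"
      "\<not> girth_bound (Suc i) \<le> card C"
    have CE: "C \<subseteq> ?E" using C(1) by auto
    then have Cm: "C \<subseteq> {..<m}" using survivors_subset[of Ind m i] by blast
    \<comment> \<open>With \<open>x\<close> largest, the query up to \<open>x\<close> contains all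
      of \<open>C\<close>. The query below \<open>x\<close> omits \<open>x\<close>, which every
      nonempty even set of survivors inside the isolating set contains.\<close>
    define x where "x = Max C"
    have fin: "finite C" using C(2) by (simp add: even_set_def)
    have x: "x \<in> C" and max: "\<And>e. e \<in> C \<Longrightarrow> e \<le> x"
      using C(2) fin by (auto simp: x_def)
    \<comment> \<open>The failed bound means \<open>card C \<le> 3 * girth_bound i div 2\<close>,
      since \<open>girth_bound\<close> adds 1 after rounding down.\<close>
    have "2 * card C \<le> 3 * girth_bound i" using C(3) by simp
    moreover have "x < m" using x Cm by auto
    ultimately obtain j where j: "j < (2 * m + 1) ^ 100"
      "isolates ?a ?b ?E C x (family_set m (family m i) j)"
      using isolating_family_family[of m i, unfolded isolating_family_iff, rule_format,
          OF u w survivors_subset Cm, of x Ind i] CE C(2) x Suc by blast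
    have "Ind (prefix_query ?E m i j x)"
    proof (subst Ind, intro conjI)
      show "prefix_query ?E m i j x \<subseteq> {..<m}"
        using survivors_subset[of Ind m i] by (auto simp: prefix_query_def)
      show "\<not> (\<exists>T\<subseteq>prefix_query ?E m i j x. T \<noteq> {} \<and> even_set ?a ?b T)"
      proof
        assume "\<exists>T\<subseteq>prefix_query ?E m i j x. T \<noteq> {} \<and> even_set ?a ?b T"
        then obtain T where T: "T \<subseteq> prefix_query ?E m i j x" "T \<noteq> {}" "even_set ?a ?b T" by blast
        then have "T \<subseteq> ?E \<inter> family_set m (family m i) j" by (auto simp: prefix_query_def)
        with T j(2) have "x \<in> T" unfolding isolates_def by blast
        with T(1) show False by (auto simp: prefix_query_def)
      qed
    qed
    moreover have "C \<subseteq> prefix_query ?E m i j (Suc x)"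
      using j(2) CE max by (auto simp: prefix_query_def isolates_def less_Suc_eq_le)
    then have "\<not> Ind (prefix_query ?E m i j (Suc x))"
      unfolding Ind using C(2) by blast
    ultimately have "x \<notin> survivors Ind m (Suc i)" using j(1) by auto
    with x C(1) show False by blast
  qed
qed

text \<open>The even set witnessing that the prefix through \<open>e\<close> is dependent must use
  \<open>e\<close>, as the prefix below \<open>e\<close> is independent. Its other edges may be
  deleted in the same round or later; they are smaller than \<open>e\<close>, which is all that
  elimination asks for.\<close>

lemma survivors_removed:
  assumes Ind: "\<And>S. Ind S \<longleftrightarrow> S \<subseteq> {..<m} \<and> \<not> (\<exists>T\<subseteq>S. T \<noteq> {} \<and> even_set a b T)"
    and "e < m" "e \<notin> survivors Ind m i"
  shows "\<exists>C. even_set a b C \<and> e \<in> C \<and> C \<subseteq> {..e}"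
  using assms(3)
proof (induction i)
  case 0
  then show ?case using assms(2) by simp
next
  case (Suc i)
  show ?case
  proof (cases "e \<in> survivors Ind m i")
    case True
    then obtain j where j: "Ind (prefix_query (survivors Ind m i) m i j e)"
      "\<not> Ind (prefix_query (survivors Ind m i) m i j (Suc e))"
      using Suc.prems by auto
    have "prefix_query (survivors Ind m i) m i j (Suc e) \<subseteq> {..<m}"
      using survivors_subset[of Ind m i] by (auto simp: prefix_query_def)
    with j(2) obtain T where T: "T \<subseteq> prefix_query (survivors Ind m i) m i j (Suc e)" "T \<noteq> {}" "even_set a b T"
      unfolding Ind by blast
    have "e \<in> T"
    proof (rule ccontr)
      assume "e \<notin> T"
      with T(1) have "T \<subseteq> prefix_query (survivors Ind m i) m i j e"
        by (auto simp: prefix_query_def less_Suc_eq)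
      with T j(1) show False unfolding Ind by blast
    qed
    moreover have "T \<subseteq> {..e}" using T(1) by (auto simp: prefix_query_def)
    ultimately show ?thesis using T(3) by blast
  qed (use Suc.IH in blast)
qed

text \<open>A nonempty even set of survivors would have more than \<open>m\<close> edges. For
  maximality, elimination trades a deleted edge \<open>e\<close> for survivors, so that
  \<open>e\<close> together with them forms a nonempty even set.\<close>

lemma survivors_basis:
  assumes "graphic_matroid {..<m} Ind" "m < girth_bound n"
  shows "matroid_basis Ind (survivors Ind m n)"
proof -
  obtain u w where uw: "u < (2 * m) ^ m" "w < (2 * m) ^ m"
    and Ind: "\<And>S. Ind S \<longleftrightarrow> S \<subseteq> {..<m} \<and>
       \<not> (\<exists>T\<subseteq>S. T \<noteq> {} \<and> even_set (digit (2 * m) u) (digit (2 * m) w) T)"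
    using graphic_matroid_digits[OF assms(1)] by blast
  let ?B = "survivors Ind m n"
  have "\<not> (\<exists>T\<subseteq>?B. T \<noteq> {} \<and> even_set (digit (2 * m) u) (digit (2 * m) w) T)"
  proof
    assume "\<exists>T\<subseteq>?B. T \<noteq> {} \<and> even_set (digit (2 * m) u) (digit (2 * m) w) T"
    then obtain T where T: "T \<subseteq> ?B" "T \<noteq> {}" "even_set (digit (2 * m) u) (digit (2 * m) w) T" by blast
    then have "girth_bound n \<le> card T"
      using survivors_girth[OF uw Ind, of n] unfolding girth_ge_def by blast
    also have "\<dots> \<le> card {..<m}"
      using T(1) survivors_subset[of Ind m n] by (intro card_mono) auto
    finally show False using assms(2) by simp
  qed
  then have "Ind ?B" unfolding Ind using survivors_subset by blast
  moreover have "S = ?B" if S: "Ind S" "?B \<subseteq> S" for S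
  proof (rule ccontr)
    assume "S \<noteq> ?B"
    then obtain e where e: "e \<in> S" "e \<notin> ?B" using S(2) by blast
    then have "e < m" using S(1) unfolding Ind by auto
    then obtain T' where T': "T' \<subseteq> ?B" "even_set (digit (2 * m) u) (digit (2 * m) w) (sym_diff {e} T')"
      using spanning_by_elimination[of m ?B "digit (2 * m) u" "digit (2 * m) w" "{e}" m]
        survivors_removed[OF Ind, of _ n] by auto
    moreover have "sym_diff {e} T' \<subseteq> S" "sym_diff {e} T' \<noteq> {}" using e T'(1) S(2) by auto
    ultimately show False using S(1) unfolding Ind by blast
  qed
  ultimately show ?thesis unfolding matroid_basis_def by blast
qed

section \<open>Number of rounds and queries\<close>

lemma girth_bound_double: "2 ^ k \<le> girth_bound (2 * k)"
  \<comment> \<open>Two rounds multiply the bound by at least \<open>9 / 4\<close>.\<close>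
  by (induction k) auto

definition rounds :: "nat \<Rightarrow> nat" where
  "rounds m = (LEAST n. m < girth_bound n)"

lemma rounds_le:
  assumes "0 < m"
  shows "real (rounds m) \<le> 2 * log 2 (real m) + 2" "m < girth_bound (rounds m)"
proof -
  define k where "k = Suc (nat \<lfloor>log 2 (real m)\<rfloor>)"
  have "0 \<le> log 2 (real m)" using assms by (subst zero_le_log_cancel_iff) auto
  then have k: "log 2 (real m) < real k" "real k \<le> log 2 (real m) + 1"
    unfolding k_def by linarith+
  then have "real m < 2 powr (real k)" using assms by (simp add: log_less_iff)
  then have "real m < real (2 ^ k)" by (simp add: powr_realpow)
  then have "m < 2 ^ k" by (simp only: of_nat_less_iff)
  also have "\<dots> \<le> girth_bound (2 * k)" by (rule girth_bound_double)
  finally have *: "m < girth_bound (2 * k)" .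
  then have "rounds m \<le> 2 * k" unfolding rounds_def by (rule Least_le)
  then show "real (rounds m) \<le> 2 * log 2 (real m) + 2" using k by linarith
  from * show "m < girth_bound (rounds m)" unfolding rounds_def by (rule LeastI)
qed

text \<open>The number of rounds is already \<open>O(log m)\<close>. For \<open>m \<ge> 4\<close>
  the logarithm is at least 2, which gives \<open>2 * log 2 m + 2 \<le> 3 * log 2 m\<close>, and the
  iterated logarithm is at least 1, so multiplying by it only enlarges the bound.\<close>

lemma rounds_bigo: "(\<lambda>m. real (rounds m)) \<in> O(\<lambda>m. log 2 (real m) * log 2 (log 2 (real m)))"
proof (rule bigoI[of _ 3])
  show "\<forall>\<^sub>F m in sequentially. norm (real (rounds m)) \<le> 3 * norm (log 2 (real m) * log 2 (log 2 (real m)))"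
    using eventually_ge_at_top[of 4]
  proof eventually_elim
    case (elim m)
    have 2: "2 \<le> log 2 (real m)"
      using elim by (subst le_log_iff) auto
    then have "log 2 2 \<le> log 2 (log 2 (real m))"
      by (subst log_le_cancel_iff) auto
    then have 1: "1 \<le> log 2 (log 2 (real m))" by simp
    have "real (rounds m) \<le> 3 * (log 2 (real m) * 1)"
      using rounds_le[of m] elim 2 by simp
    also have "\<dots> \<le> 3 * (log 2 (real m) * log 2 (log 2 (real m)))"
      using 1 2 by (intro mult_left_mono) auto
    finally show ?case using 1 2 by simp
  qed
qed

lemma query_count_bigo: "(\<lambda>m. real ((2 * m + 1) ^ 100 * (m + 1))) \<in> O(\<lambda>m. real m ^ 101)"
proof (rule bigoI[of _ "3 ^ 100 * 2"])
  show "\<forall>\<^sub>F m in sequentially. norm (real ((2 * m + 1) ^ 100 * (m + 1))) \<le> 3 ^ 100 * 2 * norm (real m ^ 101)"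
    using eventually_ge_at_top[of 1]
  proof eventually_elim
    case (elim m)
    have "(2 * m + 1) ^ 100 * (m + 1) \<le> (3 * m) ^ 100 * (2 * m)"
      using elim by (intro mult_mono power_mono) auto
    also have "\<dots> = 3 ^ 100 * 2 * m ^ 101"
      using power_Suc2[of m 100] by (simp add: power_mult_distrib)
    finally have "real ((2 * m + 1) ^ 100 * (m + 1)) \<le> real (3 ^ 100 * 2 * m ^ 101)"
      by (simp only: of_nat_le_iff)
    then show ?case by simp
  qed
qed

theorem theorem1p4:
  "\<exists>(A :: algorithm) (R :: nat \<Rightarrow> nat) (P :: nat \<Rightarrow> nat) (d :: nat).
     uniform A \<and>
     (\<lambda>m. real (R m)) \<in> O(\<lambda>m. log 2 (real m) * log 2 (log 2 (real m))) \<and>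
     (\<lambda>m. real (P m)) \<in> O(\<lambda>m. real m ^ d) \<and>
     (\<forall>(m :: nat) (Ind :: nat set \<Rightarrow> bool). graphic_matroid {..<m} Ind \<longrightarrow>
        (\<exists>h B. run A m Ind h B \<and> matroid_basis Ind B \<and>
           length h \<le> R m \<and> (\<forall>as\<in>set h. length as \<le> P m)))"
proof (intro exI conjI allI impI)
  let ?A = "\<lambda>m h. decode_action (basis_step (encode_input m h))"
  show "uniform ?A"
    unfolding uniform_def using computable_basis_step by blast
  show "(\<lambda>m. real (rounds m)) \<in> O(\<lambda>m. log 2 (real m) * log 2 (log 2 (real m)))"
    by (rule rounds_bigo)
  show "(\<lambda>m. real ((2 * m + 1) ^ 100 * (m + 1))) \<in> O(\<lambda>m. real m ^ 101)"
    by (rule query_count_bigo)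
  fix m :: nat and Ind :: "nat set \<Rightarrow> bool"
  assume graphic: "graphic_matroid {..<m} Ind"
  let ?h = "transcript Ind m (rounds m)"
  have fin: "m < girth_bound (rounds m)"
  proof (cases "m = 0")
    case True
    then show ?thesis using girth_bound_pos by simp
  qed (simp add: rounds_le)
  have "\<exists>qs. ?A m (take i ?h) = Query qs \<and> (\<forall>S\<in>set qs. S \<subseteq> {..<m}) \<and> ?h ! i = map Ind qs"
    if "i < length ?h" for i
  proof (intro exI conjI ballI)
    have i: "i < rounds m" using that by (simp add: transcript_def)
    then have "take i ?h = transcript Ind m i" by (simp add: transcript_def take_map)
    \<comment> \<open>As \<open>rounds m\<close> is least, the stopping test fails in every earlier
      round.\<close>
    moreover have "\<not> m < girth_bound i" using i unfolding rounds_def by (rule not_less_Least)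
    ultimately show "?A m (take i ?h) = Query (queries Ind m i)" by (simp add: decode_next_action)
    show "?h ! i = map Ind (queries Ind m i)" using i by (simp add: transcript_def)
    show "S \<subseteq> {..<m}" if "S \<in> set (queries Ind m i)" for S
      using that survivors_subset[of Ind m i] by (auto simp: queries_def prefix_query_def)
  qed
  then show "run ?A m Ind ?h (survivors Ind m (rounds m))"
    unfolding run_def using fin by (simp add: decode_next_action)
  show "matroid_basis Ind (survivors Ind m (rounds m))"
    using graphic fin by (rule survivors_basis)
  show "length ?h \<le> rounds m" by (simp add: transcript_def)
  show "\<forall>as\<in>set ?h. length as \<le> (2 * m + 1) ^ 100 * (m + 1)"
    by (auto simp: transcript_def queries_def)
qed

end
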